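(* Up to isomorphism there are exactly $10$ meet semilattices $P$ with $9$ elements for which there exists a GCD closed set $S$ of $9$ positive integers such that $(S,\mid)$ is isomorphic to $P$ and the LCM matrix $[S]$ is singular. These are precisely the structures $9_A, 9_B, 9_C, 9_D, 9_E, 9_F, 9_G, 9_H, 9_I, 9_J$ defined in the context.
   Context: A finite set $S=\{x_1,\ldots,x_n\}$ of distinct positive integers is GCD closed if $\gcd(x_i,x_j)\in S$ for all $i,j$. Then $(S,\mid)$, i.e. $S$ ordered by divisibility, is a meet semilattice with meet $\gcd$. The LCM matrix $[S]$ is the $n\times n$ matrix whose $ij$ entry is $\mathrm{lcm}(x_i,x_j)$. Let $Q$ be the $8$-element cube semilattice (the Boolean lattice of subsets of a three-element set), with bottom element $0$, atoms $a,b,c$, coatoms $ab, ac, bc$ (where $ab$ covers $a$ and $b$, $ac$ covers $a$ and $c$, and $bc$ covers $b$ and $c$), and top element $1$. Each of the following $9$-element meet semilattices is obtained from $Q$ by adding one new element $e$. All order relations of $Q$ are kept, no further relations among elements of $Q$ are introduced, and the order is the one generated by $Q$ together with the stated relations for $e$: - $9_A$: $e$ is a new maximal element covering only $0$. - $9_B$: $e$ is a new maximal element covering only the atom $c$. - $9_C$: $e$ is a new maximal element covering only the coatom $bc$. - $9_D$: $e$ is a new top element covering only $1$. - $9_E$: $e$ is a new bottom element, covered only by $0$. - $9_F$: $0<e<ab$ ($e$ covers only $0$ and is covered only by the coatom $ab$). - $9_G$: $a<e<ab$ ($e$ is inserted between the atom $a$ and the coatom $ab$). - $9_H$: $ab<e<1$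 ($e$ is inserted between the coatom $ab$ and the top). - $9_I$: $a<e<1$ ($e$ covers only the atom $a$ and is covered only by the top $1$). - $9_J$: $0<e<1$ ($e$ covers only $0$ and is covered only by the top $1$). *)

theory Defs
  imports
    "HOL-Algebra.Lattice"
    "Jordan_Normal_Form.Determinant"
begin

definition order_iso :: "'a gorder \<Rightarrow> 'b gorder \<Rightarrow> ('a \<Rightarrow> 'b) \<Rightarrow> bool" where
  "order_iso P R f \<longleftrightarrow>
     bij_betw f (carrier P) (carrier R) \<and>
     (\<forall>x\<in>carrier P. \<forall>y\<in>carrier P. x \<sqsubseteq>\<^bsub>P\<^esub> y \<longleftrightarrow> f x \<sqsubseteq>\<^bsub>R\<^esub> f y)"

definition order_isomorphic :: "'a gorder \<Rightarrow> 'b gorder \<Rightarrow> bool" where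
  "order_isomorphic P R \<longleftrightarrow> (\<exists>f. order_iso P R f)"

definition gcd_closed :: "nat set \<Rightarrow> bool" where
  "gcd_closed S \<longleftrightarrow> (\<forall>x\<in>S. \<forall>y\<in>S. gcd x y \<in> S)"

definition dvd_order :: "nat set \<Rightarrow> nat gorder" where
  "dvd_order S = \<lparr>carrier = S, eq = (=), le = (dvd)\<rparr>"

(* The elements of the finite set S are indexed in increasing order; another indexing
   permutes rows and columns simultaneously and does not change the determinant. *)
definition lcm_matrix :: "nat set \<Rightarrow> real mat" where
  "lcm_matrix S =
     (let xs = sorted_list_of_set S
      in mat (card S) (card S) (\<lambda>(i, j). real (lcm (xs ! i) (xs ! j))))"

definition singular_mat :: "real mat \<Rightarrow> bool" where
  "singular_mat A \<longleftrightarrow> det A = 0"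

(* Bot and Top are the elements 0 and 1 of the cube; E is the element added to it. *)
datatype elt = Bot | A | B | C | AB | AC | BC | Top | E

(* Pairs (x, y) such that y covers x in the cube. *)
definition cube_covers :: "(elt \<times> elt) set" where
  "cube_covers =
     {(Bot, A), (Bot, B), (Bot, C),
      (A, AB), (B, AB), (A, AC), (C, AC), (B, BC), (C, BC),
      (AB, Top), (AC, Top), (BC, Top)}"

(* The order generated by the cube and the relations r (pairs (x, y) meaning x < y). *)
definition cube_extension :: "(elt \<times> elt) set \<Rightarrow> elt gorder" where
  "cube_extension r =
     \<lparr>carrier = UNIV, eq = (=), le = (\<lambda>x y. (x, y) \<in> (cube_covers \<union> r)\<^sup>*)\<rparr>"

definition nine_A :: "elt gorder" where "nine_A = cube_extension {(Bot, E)}"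
definition nine_B :: "elt gorder" where "nine_B = cube_extension {(C, E)}"
definition nine_C :: "elt gorder" where "nine_C = cube_extension {(BC, E)}"
definition nine_D :: "elt gorder" where "nine_D = cube_extension {(Top, E)}"
definition nine_E :: "elt gorder" where "nine_E = cube_extension {(E, Bot)}"
definition nine_F :: "elt gorder" where "nine_F = cube_extension {(Bot, E), (E, AB)}"
definition nine_G :: "elt gorder" where "nine_G = cube_extension {(A, E), (E, AB)}"
definition nine_H :: "elt gorder" where "nine_H = cube_extension {(AB, E), (E, Top)}"
definition nine_I :: "elt gorder" where "nine_I = cube_extension {(A, E), (E, Top)}"
definition nine_J :: "elt gorder" where "nine_J = cube_extension {(Bot, E), (E, Top)}"

definition nine_structures :: "elt gorder set" where
  "nine_structures =
     {nine_A, nine_B, nine_C, nine_D, nine_E, nine_F, nine_G, nine_H, nine_I, nine_J}"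

end

theory Submission
  imports Defs
begin

text \<open>Write \<open>1 / gcd x y\<close> as the sum of \<open>psi S z\<close> over the common divisors \<open>z\<close> of \<open>x\<close> and \<open>y\<close> in
  \<open>S\<close>. A linear relation between the rows of \<open>[S]\<close> then forces \<open>psi S x = 0\<close> for some \<open>x\<close>, that
  is, the sum of \<open>psi\<close> over the order ideal generated by the coatoms of \<open>x\<close> is \<open>1 / x > 0\<close>.
  If \<open>y\<close> is a leaf of an antichain (its gcds with the other members all divide one of them, \<open>g\<close>),
  removing \<open>y\<close> changes the ideal sum by \<open>1 / g - 1 / y > 0\<close>, and for two generators the ideal sum
  is at most 0. So some set of at least three coatoms has no leaf. With nine elements available
  such a set has exactly three members, and these generate a cube below \<open>x\<close>. Locating the ninth
  element relative to the cube leaves the ten structures, apart from the position between the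
  bottom and an atom, which is excluded because the atoms are prime multiples of the bottom.\<close>

section \<open>Cube extensions\<close>

lemma UNIV_elt: "(UNIV :: elt set) = {Bot, A, B, C, AB, AC, BC, Top, E}"
  by (auto intro: elt.exhaust)

instance elt :: finite
  by standard (simp add: UNIV_elt)

lemma all_elt: "(\<forall>t. P t) \<longleftrightarrow> P Bot \<and> P A \<and> P B \<and> P C \<and> P AB \<and> P AC \<and> P BC \<and> P Top \<and> P E"
  by (metis elt.exhaust)

lemma sum_elt:
  "(\<Sum>t\<in>UNIV. f t) = f Bot + f A + f B + f C + f AB + f AC + f BC + f Top + (f E :: 'b :: comm_monoid_add)"
  by (simp add: UNIV_elt ac_simps)

text \<open>The cube has rank three, so a comparability is an equality, a cover, or involves the
  bottom or the top. In this form simplification can evaluate the order, without a transitive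
  closure. \<open>E\<close> is related to nothing here, not even to itself.\<close>

definition cube_le :: "elt \<Rightarrow> elt \<Rightarrow> bool" where
  "cube_le s t \<longleftrightarrow> s \<noteq> E \<and> t \<noteq> E \<and> (s = t \<or> s = Bot \<or> t = Top \<or> (s, t) \<in> cube_covers)"

lemma cube_le_simps [simp]:
  "\<not> cube_le E t" "\<not> cube_le t E"
  "cube_le Bot t \<longleftrightarrow> t \<noteq> E" "cube_le t Top \<longleftrightarrow> t \<noteq> E"
  "cube_le t Bot \<longleftrightarrow> t = Bot" "cube_le Top t \<longleftrightarrow> t = Top"
  "cube_le A t \<longleftrightarrow> t \<in> {A, AB, AC, Top}"
  "cube_le B t \<longleftrightarrow> t \<in> {B, AB, BC, Top}"
  "cube_le C t \<longleftrightarrow> t \<in> {C, AC, BC, Top}"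
  "cube_le AB t \<longleftrightarrow> t \<in> {AB, Top}"
  "cube_le AC t \<longleftrightarrow> t \<in> {AC, Top}"
  "cube_le BC t \<longleftrightarrow> t \<in> {BC, Top}"
  by (cases t; simp add: cube_le_def cube_covers_def)+

lemma cube_le_trans: "cube_le s t \<Longrightarrow> cube_le t u \<Longrightarrow> cube_le s u"
  by (cases s; cases t; cases u; simp)

lemma cube_le_rtrancl:
  assumes "cube_le s t"
  shows "(s, t) \<in> cube_covers\<^sup>*"
proof -
  have cov: "(Bot, A) \<in> cube_covers" "(Bot, B) \<in> cube_covers" "(Bot, C) \<in> cube_covers"
    "(A, AB) \<in> cube_covers" "(A, AC) \<in> cube_covers" "(B, BC) \<in> cube_covers"
    "(AB, Top) \<in> cube_covers" "(AC, Top) \<in> cube_covers" "(BC, Top) \<in> cube_covers"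
    "(B, AB) \<in> cube_covers" "(C, AC) \<in> cube_covers" "(C, BC) \<in> cube_covers"
    by (simp_all add: cube_covers_def)
  \<comment> \<open>\<open>1\<close>, \<open>2\<close> and \<open>3\<close> hold chains of one, two
    and three covers; together they join every pair of distinct comparable elements.\<close>
  note 1 = cov[THEN r_into_rtrancl]
  note 2 = 1(1)[THEN rtrancl_trans, OF 1(4)] 1(1)[THEN rtrancl_trans, OF 1(5)]
    1(2)[THEN rtrancl_trans, OF 1(6)]
    1(4)[THEN rtrancl_trans, OF 1(7)] 1(6)[THEN rtrancl_trans, OF 1(9)]
    1(11)[THEN rtrancl_trans, OF 1(8)]
  note 3 = 2(1)[THEN rtrancl_trans, OF 1(7)]
  show ?thesis
    using assms by (cases s; cases t; simp add: 1 2 3)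
qed

definition below :: "(elt \<times> elt) set \<Rightarrow> elt \<Rightarrow> bool" where
  "below r t \<longleftrightarrow> (\<exists>d. (d, E) \<in> r \<and> cube_le t d)"

definition above :: "(elt \<times> elt) set \<Rightarrow> elt \<Rightarrow> bool" where
  "above r t \<longleftrightarrow> (\<exists>u. (E, u) \<in> r \<and> cube_le u t)"

text \<open>Closed form of the generated order: comparing a cube element with \<open>E\<close> takes
  one pair of \<open>r\<close> and one comparison inside the cube.\<close>

definition ext_le :: "(elt \<times> elt) set \<Rightarrow> elt \<Rightarrow> elt \<Rightarrow> bool" where
  "ext_le r s t \<longleftrightarrow> cube_le s t \<or> s = E \<and> t = E \<or> t = E \<and> below r s \<or> s = E \<and> above r t"

text \<open>The second clause says that passing through \<open>E\<close> creates no new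
  comparability between cube elements; this makes \<open>ext_le\<close> transitive.\<close>

definition ext_rel :: "(elt \<times> elt) set \<Rightarrow> bool" where
  "ext_rel r \<longleftrightarrow> (\<forall>(s, t)\<in>r. (s = E) \<noteq> (t = E)) \<and>
     (\<forall>d u. (d, E) \<in> r \<longrightarrow> (E, u) \<in> r \<longrightarrow> cube_le d u)"

text \<open>\<open>ext_le\<close> is reflexive, transitive and contains the generating pairs, so it
  contains the closure; conversely each of its clauses is realized by a chain of generating
  pairs.\<close>

lemma cube_extension_le:
  assumes "ext_rel r"
  shows "s \<sqsubseteq>\<^bsub>cube_extension r\<^esub> t \<longleftrightarrow> ext_le r s t"
proof -
  have refl: "ext_le r u u" for u
    by (cases u; simp add: ext_le_def)
  have "below r s" if "cube_le s t" "below r t" for s t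
    using that cube_le_trans unfolding below_def by blast
  moreover have "above r v" if "above r t" "cube_le t v" for t v
    using that cube_le_trans unfolding above_def by blast
  moreover have "cube_le s v" if sv: "below r s" "above r v" for s v
  proof -
    obtain d u where "(d, E) \<in> r" "cube_le s d" "(E, u) \<in> r" "cube_le u v"
      using sv unfolding below_def above_def by blast
    moreover from this have "cube_le d u" using assms by (simp add: ext_rel_def)
    ultimately show ?thesis using cube_le_trans by blast
  qed
  moreover have "\<not> below r E" "\<not> above r E"
    by (simp_all add: below_def above_def)
  ultimately have trans: "ext_le r s v" if "ext_le r s t" "ext_le r t v" for s t v
    using that cube_le_trans unfolding ext_le_def by (metis cube_le_simps(1,2))
  have base: "ext_le r s t" if "(s, t) \<in> cube_covers \<union> r" for s t
  proof (cases "(s, t) \<in> r")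
    case True
    then have "(s = E) \<noteq> (t = E)" using assms by (auto simp: ext_rel_def)
    moreover have "cube_le u u" if "u \<noteq> E" for u using that by (simp add: cube_le_def)
    ultimately show ?thesis using True
      unfolding ext_le_def below_def above_def by blast
  next
    case False
    with that have "cube_le s t" by (auto simp: cube_covers_def)
    then show ?thesis by (simp add: ext_le_def)
  qed
  have cube: "(s, t) \<in> (cube_covers \<union> r)\<^sup>*" if "cube_le s t" for s t
    using cube_le_rtrancl[OF that] by (meson in_rtrancl_UnI)
  have "(s, t) \<in> (cube_covers \<union> r)\<^sup>*" if "ext_le r s t" for s t
    using that unfolding ext_le_def below_def above_def
    by (auto intro: cube intro: rtrancl_into_rtrancl converse_rtrancl_into_rtrancl)
  moreover have "ext_le r s t" if "(s, t) \<in> (cube_covers \<union> r)\<^sup>*" for s t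
    using that by induction (auto intro: refl trans base)
  ultimately show ?thesis
    unfolding cube_extension_def by auto
qed

section \<open>Order isomorphisms and an invariant that separates the ten structures\<close>

lemma order_isomorphic_sym:
  assumes "order_isomorphic P R" shows "order_isomorphic R P"
proof -
  obtain f where f: "bij_betw f (carrier P) (carrier R)"
    and le: "\<And>x y. x \<in> carrier P \<Longrightarrow> y \<in> carrier P \<Longrightarrow> x \<sqsubseteq>\<^bsub>P\<^esub> y \<longleftrightarrow> f x \<sqsubseteq>\<^bsub>R\<^esub> f y"
    using assms unfolding order_isomorphic_def order_iso_def by blast
  let ?g = "the_inv_into (carrier P) f"
  have g: "?g y \<in> carrier P" "f (?g y) = y" if "y \<in> carrier R" for y
    using that f by (metis bij_betw_def f_the_inv_into_f_bij_betw the_inv_into_into subset_refl)+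
  have "order_iso R P ?g"
    unfolding order_iso_def using f g le by (simp add: bij_betw_the_inv_into)
  then show ?thesis unfolding order_isomorphic_def by blast
qed

lemma order_isomorphic_trans:
  assumes "order_isomorphic P R" "order_isomorphic R T" shows "order_isomorphic P T"
proof -
  obtain f g where "order_iso P R f" "order_iso R T g"
    using assms unfolding order_isomorphic_def by blast
  then have "order_iso P T (g \<circ> f)"
    unfolding order_iso_def by (auto intro: bij_betw_trans dest: bij_betwE)
  then show ?thesis unfolding order_isomorphic_def by blast
qed

text \<open>Squares are taken because the number of comparable pairs alone does not separate the
  structures: \<open>nine_D\<close> and \<open>nine_E\<close> both have 36, counting reflexive
  pairs.\<close>

definition downset_invariant :: "'a gorder \<Rightarrow> int" where
  "downset_invariant P = (\<Sum>x\<in>carrier P. (\<Sum>y\<in>carrier P. of_bool (y \<sqsubseteq>\<^bsub>P\<^esub> x))\<^sup>2)"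

lemma downset_invariant_cong:
  assumes "order_isomorphic P R" shows "downset_invariant P = downset_invariant R"
proof -
  obtain f where f: "bij_betw f (carrier P) (carrier R)"
    and le: "\<And>x y. x \<in> carrier P \<Longrightarrow> y \<in> carrier P \<Longrightarrow> x \<sqsubseteq>\<^bsub>P\<^esub> y \<longleftrightarrow> f x \<sqsubseteq>\<^bsub>R\<^esub> f y"
    using assms unfolding order_isomorphic_def order_iso_def by blast
  show ?thesis
    unfolding downset_invariant_def
    by (simp add: sum.reindex_bij_betw[OF f, symmetric] le cong: sum.cong)
qed

lemma ext_rel_nine:
  "ext_rel {(Bot, E)}" "ext_rel {(C, E)}" "ext_rel {(BC, E)}" "ext_rel {(Top, E)}"
  "ext_rel {(E, Bot)}" "ext_rel {(Bot, E), (E, AB)}" "ext_rel {(A, E), (E, AB)}"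
  "ext_rel {(AB, E), (E, Top)}" "ext_rel {(A, E), (E, Top)}" "ext_rel {(Bot, E), (E, Top)}"
  by (auto simp: ext_rel_def)

lemma carrier_cube_extension [simp]: "carrier (cube_extension r) = UNIV"
  by (simp add: cube_extension_def)

lemma downset_invariant_cube_extension:
  assumes "ext_rel r"
  shows "downset_invariant (cube_extension r) =
    (1 + of_bool (above r Bot))\<^sup>2 + (2 + of_bool (above r A))\<^sup>2 + (2 + of_bool (above r B))\<^sup>2 +
    (2 + of_bool (above r C))\<^sup>2 + (4 + of_bool (above r AB))\<^sup>2 + (4 + of_bool (above r AC))\<^sup>2 +
    (4 + of_bool (above r BC))\<^sup>2 + (8 + of_bool (above r Top))\<^sup>2 +
    (1 + of_bool (below r Bot) + of_bool (below r A) + of_bool (below r B) +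
     of_bool (below r C) + of_bool (below r AB) + of_bool (below r AC) +
     of_bool (below r BC) + of_bool (below r Top))\<^sup>2"
proof -
  have "\<not> below r E" "\<not> above r E"
    by (simp_all add: below_def above_def)
  then have le: "ext_le r E E" "\<And>t. t \<noteq> E \<Longrightarrow> ext_le r E t \<longleftrightarrow> above r t"
    "\<And>s. s \<noteq> E \<Longrightarrow> ext_le r s E \<longleftrightarrow> below r s"
    "\<And>s t. s \<noteq> E \<Longrightarrow> t \<noteq> E \<Longrightarrow> ext_le r s t \<longleftrightarrow> cube_le s t"
    by (auto simp: ext_le_def)
  show ?thesis
    unfolding downset_invariant_def
    by (simp add: cube_extension_le[OF assms] sum_elt le del: sum_of_bool_eq)
qed

lemma downset_invariant_nine:
  "downset_invariant nine_A = 129" "downset_invariant nine_B = 134"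
  "downset_invariant nine_C = 150" "downset_invariant nine_D = 206"
  "downset_invariant nine_E = 188" "downset_invariant nine_F = 155"
  "downset_invariant nine_G = 160" "downset_invariant nine_H = 167"
  "downset_invariant nine_I = 151" "downset_invariant nine_J = 146"
  unfolding nine_A_def nine_B_def nine_C_def nine_D_def nine_E_def
    nine_F_def nine_G_def nine_H_def nine_I_def nine_J_def
  by (simp_all add: downset_invariant_cube_extension ext_rel_nine below_def above_def)

lemma inj_on_downset_invariant: "inj_on downset_invariant nine_structures"
  by (simp add: nine_structures_def inj_on_def downset_invariant_nine)

lemma card_nine_structures: "card nine_structures = 10"
proof -
  have "card nine_structures = card (downset_invariant ` nine_structures)"
    by (simp add: card_image inj_on_downset_invariant)
  also have "downset_invariant ` nine_structures =
      {129, 134, 150, 206, 188, 155, 160, 167, 151, 146}"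
    by (simp add: nine_structures_def downset_invariant_nine)
  finally show ?thesis by simp
qed

section \<open>Cubes generated by three coatoms\<close>

definition elt_table ::
  "nat \<Rightarrow> nat \<Rightarrow> nat \<Rightarrow> nat \<Rightarrow> nat \<Rightarrow> nat \<Rightarrow> nat \<Rightarrow> nat \<Rightarrow> nat \<Rightarrow> elt \<Rightarrow> nat" where
  "elt_table z a b c p q r x e t = (case t of
     Bot \<Rightarrow> z | A \<Rightarrow> a | B \<Rightarrow> b | C \<Rightarrow> c | AB \<Rightarrow> p | AC \<Rightarrow> q | BC \<Rightarrow> r | Top \<Rightarrow> x | E \<Rightarrow> e)"

definition cube_map :: "nat \<Rightarrow> nat \<Rightarrow> nat \<Rightarrow> nat \<Rightarrow> nat \<Rightarrow> elt \<Rightarrow> nat" where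
  "cube_map p q r x e =
     elt_table (gcd p (gcd q r)) (gcd p q) (gcd p r) (gcd q r) p q r x e"

lemma cube_map_simps [simp]:
  "cube_map p q r x e Bot = gcd p (gcd q r)"
  "cube_map p q r x e A = gcd p q"
  "cube_map p q r x e B = gcd p r"
  "cube_map p q r x e C = gcd q r"
  "cube_map p q r x e AB = p"
  "cube_map p q r x e AC = q"
  "cube_map p q r x e BC = r"
  "cube_map p q r x e Top = x"
  "cube_map p q r x e E = e"
  by (simp_all add: cube_map_def elt_table_def)

text \<open>The three non-divisibilities carry all incomparabilities of the cube. For coatoms,
  \<open>p dvd q\<close> would give \<open>gcd p r dvd q\<close>; for atoms,
  \<open>gcd p q dvd gcd p r\<close> would give \<open>gcd p q dvd r\<close>.\<close>

definition is_cube :: "nat \<Rightarrow> nat \<Rightarrow> nat \<Rightarrow> nat \<Rightarrow> bool" where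
  "is_cube p q r x \<longleftrightarrow> p dvd x \<and> q dvd x \<and> r dvd x \<and> p \<noteq> x \<and> q \<noteq> x \<and> r \<noteq> x \<and>
     \<not> gcd p q dvd r \<and> \<not> gcd p r dvd q \<and> \<not> gcd q r dvd p"

lemma cube_map_dvd_iff:
  assumes "is_cube p q r x" "s \<noteq> E" "t \<noteq> E"
  shows "cube_map p q r x e s dvd cube_map p q r x e t \<longleftrightarrow> cube_le s t"
proof -
  have x: "p dvd x" "q dvd x" "r dvd x" "\<not> x dvd p" "\<not> x dvd q" "\<not> x dvd r"
    and g: "\<not> gcd p q dvd r" "\<not> gcd p r dvd q" "\<not> gcd q r dvd p"
    using assms(1) unfolding is_cube_def by (auto dest: dvd_antisym)
  have "\<not> gcd q p dvd r" "\<not> gcd r p dvd q" "\<not> gcd r q dvd p"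
    using g by (simp_all add: gcd.commute)
  note g = g this
  have a: "\<not> p dvd q" "\<not> p dvd r" "\<not> q dvd p" "\<not> q dvd r" "\<not> r dvd p" "\<not> r dvd q"
    using g by (meson gcd_dvd1 gcd_dvd2 dvd_trans)+
  have y: "gcd p s dvd x" "gcd q s dvd x" "gcd r s dvd x" for s
    using x by (meson gcd_dvd1 dvd_trans)+
  have n: "\<not> x dvd gcd p s" "\<not> x dvd gcd q s" "\<not> x dvd gcd r s" for s
    using x by (meson gcd_dvd1 dvd_trans)+
  show ?thesis using assms(2,3)
    by (cases s; cases t; simp add: x g a y n; meson gcd_dvd1 gcd_dvd2 dvd_trans)
qed

text \<open>The hypothesis \<open>excl\<close> yields injectivity: if \<open>e\<close> coincided
  with a cube element, that element would lie both below and above \<open>E\<close>.\<close>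

lemma order_isomorphic_cube_extension:
  assumes cube: "is_cube p q r x" and r: "ext_rel l"
    and below: "\<And>t. t \<noteq> E \<Longrightarrow> cube_map p q r x e t dvd e \<longleftrightarrow> below l t"
    and above: "\<And>t. t \<noteq> E \<Longrightarrow> e dvd cube_map p q r x e t \<longleftrightarrow> above l t"
    and S: "S = range (cube_map p q r x e)"
    and excl: "\<And>t. t \<noteq> E \<Longrightarrow> \<not> (below l t \<and> above l t)"
  shows "order_isomorphic (cube_extension l) (dvd_order S)"
proof -
  let ?h = "cube_map p q r x e"
  have E: "?h E = e" by simp
  have le: "ext_le l s t \<longleftrightarrow> ?h s dvd ?h t" for s t
  proof -
    have "\<not> below l E" "\<not> above l E" by (simp_all add: below_def above_def)
    then show ?thesis
      using cube_map_dvd_iff[OF cube, of s t] below[of s] above[of t]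
      by (cases "s = E"; cases "t = E"; simp add: ext_le_def)
  qed
  have antisym: "s = t" if "cube_le s t" "cube_le t s" for s t
    using that by (cases s; cases t; simp)
  have "inj ?h"
  proof (rule injI)
    fix s t assume "?h s = ?h t"
    then have "ext_le l s t" "ext_le l t s" unfolding le by simp_all
    then show "s = t"
      using excl antisym unfolding ext_le_def by (metis cube_le_simps(1,2))
  qed
  then have "order_iso (cube_extension l) (dvd_order S) ?h"
    unfolding order_iso_def cube_extension_le[OF r] le
    by (simp add: dvd_order_def S bij_betw_def)
  then show ?thesis unfolding order_isomorphic_def by blast
qed

section \<open>Singular LCM matrices\<close>

text \<open>Replaces positions in the sorted list by elements of \<open>S\<close>, so that kernel
  vectors become functions on \<open>S\<close>.\<close>

lemma singular_lcm_matrix_iff: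
  assumes "finite S"
  shows "singular_mat (lcm_matrix S) \<longleftrightarrow>
    (\<exists>c. (\<exists>y\<in>S. c y \<noteq> 0) \<and> (\<forall>x\<in>S. (\<Sum>y\<in>S. real (lcm x y) * c y) = 0))"
proof -
  define xs where "xs = sorted_list_of_set S"
  define n where "n = card S"
  define M where "M = mat n n (\<lambda>(i, j). real (lcm (xs ! i) (xs ! j)))"
  have bij: "bij_betw ((!) xs) {0..<n} S"
    unfolding xs_def n_def using assms
    by (intro bij_betw_nth) (simp_all add: atLeast0LessThan)
  have M: "M \<in> carrier_mat n n" by (simp add: M_def)
  have prod: "(M *\<^sub>v v) $ i = (\<Sum>j\<in>{0..<n}. real (lcm (xs ! i) (xs ! j)) * v $ j)"
    if "v \<in> carrier_vec n" "i < n" for v i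
    using that by (simp add: M_def scalar_prod_def)
  have "singular_mat (lcm_matrix S) \<longleftrightarrow> det M = 0"
    by (simp add: singular_mat_def lcm_matrix_def M_def xs_def n_def Let_def)
  also have "\<dots> \<longleftrightarrow> (\<exists>v. v \<in> carrier_vec n \<and> v \<noteq> 0\<^sub>v n \<and> M *\<^sub>v v = 0\<^sub>v n)"
    by (rule det_0_iff_vec_prod_zero_field[OF M])
  also have "\<dots> \<longleftrightarrow> (\<exists>c. (\<exists>y\<in>S. c y \<noteq> 0) \<and> (\<forall>x\<in>S. (\<Sum>y\<in>S. real (lcm x y) * c y) = 0))"
    (is "_ \<longleftrightarrow> ?R")
  proof (intro iffI; elim exE conjE)
    fix v assume v: "v \<in> carrier_vec n" "v \<noteq> 0\<^sub>v n" "M *\<^sub>v v = 0\<^sub>v n"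
    define c where "c y = v $ (the_inv_into {0..<n} ((!) xs) y)" for y
    have c: "c (xs ! i) = v $ i" if "i < n" for i
      unfolding c_def using bij that by (simp add: bij_betw_def the_inv_into_f_f)
    obtain i where "i < n" "v $ i \<noteq> 0"
      using v(1,2) by (metis carrier_vecD eq_vecI index_zero_vec(1,2))
    then have "xs ! i \<in> S" "c (xs ! i) \<noteq> 0"
      using c bij_betwE[OF bij] by auto
    moreover have "(\<Sum>y\<in>S. real (lcm x y) * c y) = 0" if "x \<in> S" for x
    proof -
      have "x \<in> (!) xs ` {0..<n}" using that bij by (simp add: bij_betw_def)
      then obtain k where k: "k < n" "x = xs ! k" by auto
      have "(\<Sum>y\<in>S. real (lcm x y) * c y) = (\<Sum>j\<in>{0..<n}. real (lcm x (xs ! j)) * c (xs ! j))"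
        by (rule sum.reindex_bij_betw[OF bij, symmetric])
      also have "\<dots> = (M *\<^sub>v v) $ k"
        using k v(1) by (simp add: prod c)
      finally show ?thesis using v(3) k by simp
    qed
    ultimately show ?R by blast
  next
    fix c :: "nat \<Rightarrow> real"
    assume c: "\<exists>y\<in>S. c y \<noteq> 0" "\<forall>x\<in>S. (\<Sum>y\<in>S. real (lcm x y) * c y) = 0"
    define v where "v = vec n (\<lambda>j. c (xs ! j))"
    have v: "v \<in> carrier_vec n" by (simp add: v_def)
    obtain i where "i < n" "c (xs ! i) \<noteq> 0"
      using c(1) bij unfolding bij_betw_def by fastforce
    then have "v \<noteq> 0\<^sub>v n" unfolding v_def by (metis index_vec index_zero_vec(1))
    moreover have "M *\<^sub>v v = 0\<^sub>v n"
    proof (rule eq_vecI)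
      fix k assume "k < dim_vec (0\<^sub>v n :: real vec)"
      then have k: "k < n" by simp
      have "(M *\<^sub>v v) $ k = (\<Sum>j\<in>{0..<n}. real (lcm (xs ! k) (xs ! j)) * c (xs ! j))"
        using k v by (simp add: prod) (simp add: v_def)
      also have "\<dots> = (\<Sum>y\<in>S. real (lcm (xs ! k) y) * c y)"
        by (rule sum.reindex_bij_betw[OF bij])
      finally show "(M *\<^sub>v v) $ k = 0\<^sub>v n $ k"
        using c(2) k bij_betwE[OF bij] by simp
    qed (simp add: M_def)
    ultimately show "\<exists>v. v \<in> carrier_vec n \<and> v \<noteq> 0\<^sub>v n \<and> M *\<^sub>v v = 0\<^sub>v n"
      using v by blast
  qed
  finally show ?thesis .
qed

text \<open>\<open>psi S\<close> is the Moebius inverse of \<open>x \<mapsto> 1 / x\<close> on the poset \<open>(S, dvd)\<close>.\<close>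

function psi :: "nat set \<Rightarrow> nat \<Rightarrow> real" where
  "psi S x = 1 / real x - (\<Sum>y\<in>{y \<in> S. y dvd x \<and> y < x}. psi S y)"
  by auto
termination by (relation "measure snd") auto

declare psi.simps [simp del]

locale gcd_closed_set =
  fixes S :: "nat set"
  assumes finite: "finite S" and pos: "x \<in> S \<Longrightarrow> 0 < x"
    and gcd: "x \<in> S \<Longrightarrow> y \<in> S \<Longrightarrow> gcd x y \<in> S"
begin

lemma sum_psi:
  assumes "x \<in> S"
  shows "(\<Sum>y\<in>{y \<in> S. y dvd x}. psi S y) = 1 / real x"
proof -
  have "{y \<in> S. y dvd x} = insert x {y \<in> S. y dvd x \<and> y < x}"
    using assms dvd_imp_le[OF _ pos[OF assms]] by (auto simp: nat_less_le)
  then have "(\<Sum>y\<in>{y \<in> S. y dvd x}. psi S y) =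
      psi S x + (\<Sum>y\<in>{y \<in> S. y dvd x \<and> y < x}. psi S y)"
    using finite by simp
  then show ?thesis by (simp add: psi.simps[of S x])
qed

text \<open>Since \<open>lcm x y\<close> is x * y times the sum of \<open>psi S z\<close> over the
  common divisors z in \<open>S\<close>, the matrix is a product of triangular incidence matrices
  and diagonal ones. If no \<open>psi S x\<close> vanishes, a kernel vector is undone in two stages:
  first \<open>D\<close> is zero, by induction upwards along divisibility, then \<open>c\<close> is
  zero, by induction downwards from \<open>Max S\<close>.\<close>

lemma ex_psi_eq_0:
  assumes "singular_mat (lcm_matrix S)"
  shows "\<exists>x\<in>S. psi S x = 0"
proof (rule ccontr)
  assume "\<not> ?thesis"
  then have nz: "psi S x \<noteq> 0" if "x \<in> S" for x using that by blast
  obtain c where c: "\<exists>y\<in>S. c y \<noteq> 0"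
    and eq: "\<And>x. x \<in> S \<Longrightarrow> (\<Sum>y\<in>S. real (lcm x y) * c y) = 0"
    using assms singular_lcm_matrix_iff[OF finite] by auto
  define D where "D z = (\<Sum>y\<in>{y \<in> S. z dvd y}. real y * c y)" for z
  have sum0: "(\<Sum>z\<in>{z \<in> S. z dvd x}. psi S z * D z) = 0" if x: "x \<in> S" for x
  proof -
    have inv: "(\<Sum>z\<in>S. of_bool (z dvd x) * of_bool (z dvd y) * psi S z) = 1 / real (gcd x y)"
      if "y \<in> S" for y
    proof -
      have "(\<Sum>z\<in>S. of_bool (z dvd x) * of_bool (z dvd y) * psi S z) =
          (\<Sum>z\<in>{z \<in> S. z dvd gcd x y}. psi S z)"
        using finite by (intro sum.mono_neutral_cong_right) auto
      then show ?thesis using sum_psi[OF gcd[OF x that]] by simp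
    qed
    have "(\<Sum>z\<in>{z \<in> S. z dvd x}. psi S z * D z) =
        (\<Sum>z\<in>S. \<Sum>y\<in>S. of_bool (z dvd x) * of_bool (z dvd y) * psi S z * (real y * c y))"
      unfolding D_def sum_distrib_left
      using finite by (intro sum.mono_neutral_cong_left) (auto intro!: sum.mono_neutral_cong_left)
    also have "\<dots> = (\<Sum>y\<in>S. real y * c y / real (gcd x y))"
      by (subst sum.swap) (simp add: sum_distrib_right[symmetric] inv)
    also have "\<dots> = (\<Sum>y\<in>S. real (lcm x y) * c y / real x)"
    proof (rule sum.cong[OF refl])
      fix y assume "y \<in> S"
      have "real (lcm x y) * real (gcd x y) = real x * real y"
        by (metis mult.commute of_nat_mult prod_gcd_lcm_nat)
      then show "real y * c y / real (gcd x y) = real (lcm x y) * c y / real x"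
        using pos[OF x] by (simp add: field_simps)
    qed
    also have "\<dots> = 0"
      using eq[OF x] by (simp add: sum_divide_distrib[symmetric])
    finally show ?thesis .
  qed
  have D0: "D x = 0" if "x \<in> S" for x
    using that
  proof (induction x rule: less_induct)
    case (less x)
    have "psi S z * D z = 0" if "z \<in> {z \<in> S. z dvd x} - {x}" for z
      using that less pos dvd_imp_le[of z x] by auto
    then have "(\<Sum>z\<in>{z \<in> S. z dvd x} - {x}. psi S z * D z) = 0"
      by (rule sum.neutral[OF ballI])
    then have "(\<Sum>z\<in>{z \<in> S. z dvd x}. psi S z * D z) = psi S x * D x"
      using less.prems finite by (simp add: sum.remove[of _ x])
    then show ?case using sum0 less.prems nz by simp
  qed
  have "c x = 0" if "x \<in> S" for x
    using that
  proof (induction "Max S - x" arbitrary: x rule: less_induct)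
    case less
    have "real y * c y = 0" if "y \<in> {y \<in> S. x dvd y} - {x}" for y
    proof -
      have "x < y" using that pos dvd_imp_le[of x y] by auto
      moreover have "y \<le> Max S" using that finite by simp
      ultimately have "Max S - y < Max S - x" by linarith
      then show ?thesis using less that by auto
    qed
    then have "(\<Sum>y\<in>{y \<in> S. x dvd y} - {x}. real y * c y) = 0"
      by (rule sum.neutral[OF ballI])
    then have "D x = real x * c x"
      unfolding D_def using less.prems finite by (simp add: sum.remove[of _ x])
    then show ?case using D0 less.prems pos by fastforce
  qed
  then show False using c by blast
qed

end

section \<open>Ideal sums and leafless antichains\<close>

context gcd_closed_set
begin

definition ideal_sum :: "nat set \<Rightarrow> real" where
  "ideal_sum Y = (\<Sum>v\<in>{v \<in> S. \<exists>y\<in>Y. v dvd y}. psi S v)"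

lemma ideal_sum_singleton: "y \<in> S \<Longrightarrow> ideal_sum {y} = 1 / real y"
  using sum_psi[of y] by (simp add: ideal_sum_def)

text \<open>Inclusion-exclusion: the common part of the ideals generated by \<open>y\<close> and by
  \<open>Y\<close> is generated by the gcds of \<open>y\<close> with the members of
  \<open>Y\<close>.\<close>

lemma ideal_sum_insert:
  assumes "y \<in> S" "Y \<subseteq> S"
  shows "ideal_sum (insert y Y) = ideal_sum Y + 1 / real y - ideal_sum (gcd y ` Y)"
proof -
  let ?A = "{v \<in> S. v dvd y}" and ?B = "{v \<in> S. \<exists>y\<in>Y. v dvd y}"
  have union: "{v \<in> S. \<exists>y'\<in>insert y Y. v dvd y'} = ?A \<union> ?B" by blast
  have inter: "?A \<inter> ?B = {v \<in> S. \<exists>z\<in>gcd y ` Y. v dvd z}" by auto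
  have "sum (psi S) (?A \<union> ?B) = sum (psi S) ?A + sum (psi S) ?B - sum (psi S) (?A \<inter> ?B)"
    using finite by (intro sum_Un) auto
  then show ?thesis
    unfolding ideal_sum_def union inter using sum_psi[OF assms(1)] by simp
qed

lemma ideal_sum_insert_leaf:
  assumes "y \<in> S" "y0 \<in> Y" "Y \<subseteq> S" "\<And>y'. y' \<in> Y \<Longrightarrow> gcd y y' dvd gcd y y0"
  shows "ideal_sum (insert y Y) = ideal_sum Y + 1 / real y - 1 / real (gcd y y0)"
proof -
  have "{v \<in> S. \<exists>z\<in>gcd y ` Y. v dvd z} = {v \<in> S. \<exists>z\<in>{gcd y y0}. v dvd z}"
    using assms(2,4) by (blast intro: dvd_trans)
  then have "ideal_sum (gcd y ` Y) = ideal_sum {gcd y y0}"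
    unfolding ideal_sum_def by simp
  then show ?thesis
    using ideal_sum_insert[OF assms(1,3)] ideal_sum_singleton assms gcd by auto
qed

end

definition antichain :: "nat set \<Rightarrow> bool" where
  "antichain Y \<longleftrightarrow> (\<forall>x\<in>Y. \<forall>y\<in>Y. x dvd y \<longrightarrow> x = y)"

definition leaf :: "nat set \<Rightarrow> nat \<Rightarrow> bool" where
  "leaf Y y \<longleftrightarrow> (\<exists>y0\<in>Y - {y}. \<forall>y'\<in>Y - {y}. gcd y y' dvd gcd y y0)"

lemma two_dvd_le:
  fixes g y :: nat
  assumes "g dvd y" "g \<noteq> y" "0 < y"
  shows "2 / real y \<le> 1 / real g"
proof -
  obtain k where k: "y = g * k" using assms(1) by blast
  then have "k \<noteq> 0" "k \<noteq> 1" using assms(2,3) by auto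
  then have "2 * g \<le> y" using k by simp
  then have "2 * real g \<le> real y" by (metis of_nat_le_iff of_nat_mult of_nat_numeral)
  moreover have "0 < g" using assms(1,3) by (simp add: dvd_pos_nat)
  ultimately show ?thesis using assms(3) by (simp add: field_simps)
qed

context gcd_closed_set
begin

text \<open>Leaves are removed until two generators remain; the assumption ranges over all subsets,
  so it survives each removal. For two incomparable generators each reciprocal is at most half the
  reciprocal of their gcd, because a proper divisor is at most half the number.\<close>

lemma ideal_sum_le_0:
  assumes "Y \<subseteq> S" "antichain Y" "2 \<le> card Y"
    and "\<And>Z. Z \<subseteq> Y \<Longrightarrow> 3 \<le> card Z \<Longrightarrow> \<exists>y\<in>Z. leaf Z y"
  shows "ideal_sum Y \<le> 0"
  using assms
proof (induction "card Y" arbitrary: Y rule: less_induct)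
  case less
  have fin: "finite Y" using less.prems(1) finite finite_subset by blast
  have ineq: "2 / real y \<le> 1 / real (gcd y z)" "2 / real z \<le> 1 / real (gcd y z)"
    if "y \<in> Y" "z \<in> Y" "z \<noteq> y" for y z
    using that less.prems(1,2) pos unfolding antichain_def
    by (auto intro!: two_dvd_le) (metis gcd_dvd1 gcd_dvd2)+
  show ?case
  proof (cases "card Y = 2")
    case True
    then obtain y z where Y: "Y = {y, z}" "y \<noteq> z" by (auto simp: card_2_iff)
    then have "ideal_sum Y = 1 / real z + 1 / real y - 1 / real (gcd y z)"
      using ideal_sum_insert_leaf[of y z "{z}"] ideal_sum_singleton[of z] less.prems(1) by simp
    then show ?thesis using ineq[of y z] Y by simp
  next
    case False
    then have "3 \<le> card Y" using less.prems(3) by simp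
    then obtain y y0 where y: "y \<in> Y" "y0 \<in> Y - {y}" "\<And>y'. y' \<in> Y - {y} \<Longrightarrow> gcd y y' dvd gcd y y0"
      using less.prems(4)[of Y] unfolding leaf_def by blast
    have "ideal_sum (Y - {y}) \<le> 0"
    proof (rule less.hyps)
      show "card (Y - {y}) < card Y" using y fin by (meson card_Diff1_less)
      show "2 \<le> card (Y - {y})" using y fin \<open>3 \<le> card Y\<close> by simp
      show "antichain (Y - {y})" using less.prems(2) by (auto simp: antichain_def)
      show "Y - {y} \<subseteq> S" using less.prems(1) by blast
      show "\<exists>y\<in>Z. leaf Z y" if "Z \<subseteq> Y - {y}" "3 \<le> card Z" for Z
        using that less.prems(4) by blast
    qed
    moreover have "ideal_sum Y = ideal_sum (Y - {y}) + 1 / real y - 1 / real (gcd y y0)"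
      using ideal_sum_insert_leaf[of y y0 "Y - {y}"] y less.prems(1)
      by (auto simp: insert_absorb)
    moreover have "1 / real y \<le> 2 / real y" by (simp add: divide_right_mono)
    ultimately show ?thesis using ineq[of y y0] y by simp
  qed
qed

section \<open>Coatoms and the extraction of a cube\<close>

definition coatoms :: "nat \<Rightarrow> nat set" where
  "coatoms x = {y \<in> S. y dvd x \<and> y \<noteq> x \<and> (\<forall>z\<in>S. y dvd z \<longrightarrow> z dvd x \<longrightarrow> z = y \<or> z = x)}"

lemma antichain_coatoms: "antichain (coatoms x)"
  unfolding antichain_def coatoms_def by blast

lemma ex_coatom:
  assumes "x \<in> S" "v \<in> S" "v dvd x" "v \<noteq> x"
  shows "\<exists>y\<in>coatoms x. v dvd y"
proof -
  let ?Z = "{z \<in> S. v dvd z \<and> z dvd x \<and> z \<noteq> x}"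
  \<comment> \<open>The numerically largest candidate is also maximal for divisibility, since a
    proper multiple would be larger.\<close>
  define y where "y = Max ?Z"
  have fin: "finite ?Z" "v \<in> ?Z" using finite assms by auto
  then have y: "y \<in> ?Z" unfolding y_def using Max_in by blast
  have "z = y" if z: "z \<in> S" "y dvd z" "z dvd x" "z \<noteq> x" for z
  proof -
    have "z \<in> ?Z" using z y by (auto intro: dvd_trans)
    then have "z \<le> y" unfolding y_def using fin by simp
    then show ?thesis using z pos dvd_imp_le[of y z] by auto
  qed
  then show ?thesis using y unfolding coatoms_def by blast
qed

lemma ideal_sum_coatoms:
  assumes "x \<in> S"
  shows "ideal_sum (coatoms x) = 1 / real x - psi S x"
proof -
  have "{v \<in> S. \<exists>y\<in>coatoms x. v dvd y} = {y \<in> S. y dvd x} - {x}"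
    using ex_coatom[OF assms] pos assms
    by (auto simp: coatoms_def intro: dvd_trans dest: dvd_antisym)
  then show ?thesis
    unfolding ideal_sum_def using sum_psi[OF assms] finite assms
    by (simp add: sum_diff1)
qed

text \<open>The ideal sum of the coatoms is \<open>1 / x\<close>. With no coatom it would be 0, with
  a single coatom y it would be 1 / y, and with two or more but no leafless subset it would be at
  most 0.\<close>

lemma ex_leafless:
  assumes "x \<in> S" "psi S x = 0"
  shows "\<exists>Z\<subseteq>coatoms x. 3 \<le> card Z \<and> (\<forall>y\<in>Z. \<not> leaf Z y)"
proof (rule ccontr)
  assume no: "\<not> ?thesis"
  have fin: "finite (coatoms x)" "coatoms x \<subseteq> S"
    using finite by (auto simp: coatoms_def)
  have eq: "ideal_sum (coatoms x) = 1 / real x" and pos_x: "0 < x"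
    using ideal_sum_coatoms assms pos by simp_all
  have "card (coatoms x) \<noteq> 0"
    using eq pos_x fin by (auto simp: ideal_sum_def)
  moreover have "card (coatoms x) \<noteq> 1"
  proof
    assume "card (coatoms x) = 1"
    then obtain y where y: "coatoms x = {y}" by (auto simp: card_1_singleton_iff)
    then have "y \<in> S" "y \<noteq> x" unfolding coatoms_def by auto
    then show False using eq y ideal_sum_singleton[of y] pos pos_x by simp
  qed
  ultimately have "2 \<le> card (coatoms x)" by simp
  then have "ideal_sum (coatoms x) \<le> 0"
    using ideal_sum_le_0[OF fin(2) antichain_coatoms] no by blast
  then show False using eq pos_x by (simp add: divide_le_0_iff)
qed

text \<open>Every member of a leafless \<open>Z\<close> lies above two incomparable elements of \<open>W = S - Z - {x, Gcd S}\<close>.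
  If \<open>Z\<close> has at least four members, then \<open>W\<close> has at most three, so two members of \<open>Z\<close> share such a
  pair \<open>v, w\<close>. Their gcd \<open>g\<close> is the third element of \<open>W\<close>, hence the gcd of any two members of \<open>Z\<close>,
  and every member is a leaf.\<close>

lemma card_leafless_eq_3:
  assumes "card S \<le> 9" "x \<in> S" "Z \<subseteq> coatoms x" "3 \<le> card Z" "\<forall>y\<in>Z. \<not> leaf Z y"
  shows "card Z = 3"
proof (rule ccontr)
  assume "card Z \<noteq> 3"
  then have card_Z: "4 \<le> card Z" using assms(4) by simp
  have ZS: "Z \<subseteq> S" "x \<notin> Z" and anti: "\<And>y z. y \<in> Z \<Longrightarrow> z \<in> Z \<Longrightarrow> y dvd z \<Longrightarrow> y = z"
    and dx: "\<And>y. y \<in> Z \<Longrightarrow> y dvd x"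
    using assms(3) antichain_coatoms[of x] unfolding coatoms_def antichain_def by blast+
  have fin_Z: "finite Z" using ZS finite finite_subset by blast
  define b where "b = Gcd S"
  define W where "W = S - Z - {x, b}"
  have bS: "b \<in> S"
  proof -
    have "\<forall>T. T \<subseteq> S \<longrightarrow> T \<noteq> {} \<longrightarrow> Gcd T \<in> S"
    proof (intro allI impI)
      fix T assume T: "T \<subseteq> S" "T \<noteq> {}"
      then have "finite T" using finite finite_subset by blast
      then show "Gcd T \<in> S" using T(2,1)
        by (induction rule: finite_ne_induct) (auto intro: gcd)
    qed
    then show ?thesis using assms(2) unfolding b_def by blast
  qed
  have b: "b dvd s" if "s \<in> S" for s using that by (simp add: b_def)
  have pairs: "\<exists>v\<in>W. \<exists>w\<in>W. v dvd y \<and> w dvd y \<and> \<not> v dvd w \<and> \<not> w dvd v" if y: "y \<in> Z" for y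
  proof -
    let ?G = "gcd y ` (Z - {y})"
    have "\<exists>z. z \<in> Z - {y}"
    proof (rule ccontr)
      assume "\<not> ?thesis"
      then have "Z \<subseteq> {y}" by blast
      then have "card Z \<le> 1" using card_mono[of "{y}" Z] by simp
      then show False using card_Z by simp
    qed
    then have G: "finite ?G" "?G \<noteq> {}" using fin_Z by auto
    \<comment> \<open>Choosing \<open>z\<close> with the largest gcd makes the two gcds
      incomparable: since \<open>z\<close> does not witness a leaf, some \<open>gcd y z'\<close>
      does not divide \<open>gcd y z\<close>, and by size the converse divisibility fails as
      well.\<close>
    then have "Max ?G \<in> ?G" by (rule Max_in)
    then obtain z where z: "z \<in> Z - {y}" "gcd y z = Max ?G" by (metis imageE)
    obtain z' where z': "z' \<in> Z - {y}" "\<not> gcd y z' dvd gcd y z"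
      using assms(5) y z unfolding leaf_def by blast
    have le: "gcd y z' \<le> gcd y z" using z z' G by simp
    have "0 < gcd y z'" using y z' ZS pos gcd by blast
    then have nd: "\<not> gcd y z dvd gcd y z'"
      using le z' by (metis dvd_imp_le dvd_refl le_antisym)
    have "gcd y u \<in> S" "gcd y u \<noteq> x" "gcd y u \<notin> Z" if "u \<in> Z - {y}" for u
    proof -
      show "gcd y u \<in> S" using that y ZS gcd by blast
      show "gcd y u \<noteq> x" using dx[OF y] y ZS(2) by (metis dvd_antisym gcd_dvd1)
      show "gcd y u \<notin> Z" using that y anti by (metis DiffE gcd_dvd1 gcd_dvd2 singletonI)
    qed
    moreover have "gcd y z \<noteq> b" "gcd y z' \<noteq> b"
      using nd z' b y ZS gcd z by (metis DiffD1 subsetD)+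
    ultimately have "gcd y z \<in> W" "gcd y z' \<in> W"
      unfolding W_def using z(1) z'(1) by auto
    then show ?thesis using nd z z' by (metis gcd_dvd1)
  qed
  have card_W: "card W \<le> 3"
  proof -
    have bZ: "b \<notin> Z"
    proof
      assume "b \<in> Z"
      then have "\<forall>y\<in>Z. y = b" using anti b ZS by blast
      then have "Z \<subseteq> {b}" by blast
      then have "card Z \<le> 1" using card_mono[of "{b}" Z] by simp
      then show False using card_Z by simp
    qed
    have bx: "b \<noteq> x"
    proof
      assume "b = x"
      obtain y where "y \<in> Z" using card_Z by fastforce
      then show False using \<open>b = x\<close> b ZS dx by (metis dvd_antisym subsetD)
    qed
    have "card (Z \<union> {x, b}) = card Z + 2"
      using bZ bx ZS fin_Z by (subst card_Un_disjoint) auto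
    moreover have "card W = card S - card (Z \<union> {x, b})"
      unfolding W_def Diff_eq Int_assoc Compl_Un[symmetric]
      using ZS assms(2) bS fin_Z by (simp add: Diff_eq[symmetric] card_Diff_subset)
    ultimately show ?thesis using card_Z assms(1) by simp
  qed
  have fin_W: "finite W" using finite by (simp add: W_def)
  define V where "V y = (SOME V. V \<subseteq> W \<and> card V = 2 \<and> (\<forall>v\<in>V. v dvd y) \<and> (\<forall>v\<in>V. \<forall>w\<in>V. v dvd w \<longrightarrow> v = w))" for y
  have V: "V y \<subseteq> W \<and> card (V y) = 2 \<and> (\<forall>v\<in>V y. v dvd y) \<and> (\<forall>v\<in>V y. \<forall>w\<in>V y. v dvd w \<longrightarrow> v = w)"
    if y: "y \<in> Z" for y
  proof -
    obtain v w where vw: "v \<in> W" "w \<in> W" "v dvd y" "w dvd y" "\<not> v dvd w" "\<not> w dvd v"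
      using pairs[OF y] by blast
    then have "{v, w} \<subseteq> W \<and> card {v, w} = 2 \<and> (\<forall>v\<in>{v, w}. v dvd y) \<and>
        (\<forall>v'\<in>{v, w}. \<forall>w'\<in>{v, w}. v' dvd w' \<longrightarrow> v' = w')" by (auto simp: card_insert_if)
    then show ?thesis unfolding V_def by (rule someI)
  qed
  have "\<not> inj_on V Z"
  proof
    assume "inj_on V Z"
    then have "card Z = card (V ` Z)" by (simp add: card_image)
    also have "\<dots> \<le> card {T. T \<subseteq> W \<and> card T = 2}"
    proof (rule card_mono)
      show "finite {T. T \<subseteq> W \<and> card T = 2}" using fin_W by simp
      show "V ` Z \<subseteq> {T. T \<subseteq> W \<and> card T = 2}" using V by blast
    qed
    also have "\<dots> = card W choose 2" by (rule n_subsets[OF fin_W])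
    also have "\<dots> \<le> 3 choose 2" using card_W by (rule binomial_right_mono)
    finally show False using card_Z by (simp add: choose_two)
  qed
  then obtain y z where yz: "y \<in> Z" "z \<in> Z" "y \<noteq> z" "V y = V z"
    unfolding inj_on_def by blast
  obtain v w where vw: "V y = {v, w}" "v \<noteq> w"
    using V[OF yz(1)] card_2_iff[of "V y"] by metis
  have vw': "v \<in> W" "w \<in> W" "v dvd y" "w dvd y" "v dvd z" "w dvd z" "\<not> v dvd w" "\<not> w dvd v"
  proof -
    have in_V: "v \<in> V y" "w \<in> V y" "v \<in> V z" "w \<in> V z"
      using vw(1) yz(4) by blast+
    show "v \<in> W" "w \<in> W" "v dvd y" "w dvd y" using V[OF yz(1)] in_V(1,2) by blast+
    show "v dvd z" "w dvd z" using V[OF yz(2)] in_V(3,4) by blast+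
    show "\<not> v dvd w" "\<not> w dvd v" using V[OF yz(1)] in_V(1,2) vw(2) by blast+
  qed
  have meet: "gcd y' u \<in> W" if "y' \<in> Z" "u \<in> Z" "y' \<noteq> u" "v dvd y'" "w dvd y'" "v dvd u" "w dvd u" for y' u
  proof -
    have "gcd y' u \<in> S" using that(1,2) ZS gcd by blast
    moreover have "gcd y' u \<noteq> x"
      using dx[OF that(1)] that(1) ZS(2) by (metis dvd_antisym gcd_dvd1)
    moreover have "gcd y' u \<notin> Z" using that(1-3) anti by (metis gcd_dvd1 gcd_dvd2)
    moreover have "gcd y' u \<noteq> b"
    proof
      assume "gcd y' u = b"
      moreover have "v dvd gcd y' u" using that by simp
      moreover have "b dvd w" using b vw'(2) by (simp add: W_def)
      ultimately show False using vw'(7) by (metis dvd_trans)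
    qed
    ultimately show ?thesis by (simp add: W_def)
  qed
  define g where "g = gcd y z"
  have g: "g \<in> W" "v dvd g" "w dvd g"
    unfolding g_def using meet[of y z] yz vw' by auto
  have W: "W = {v, w, g}"
  proof -
    have "g \<noteq> v" "g \<noteq> w" using g vw' by auto
    then have "card {v, w, g} = 3" using vw(2) by simp
    moreover have "{v, w, g} \<subseteq> W" using g vw' by simp
    ultimately show ?thesis using card_W fin_W by (metis card_seteq)
  qed
  \<comment> \<open>In \<open>{v, w, g}\<close> the element \<open>g\<close> lies above the other
    two, so the only incomparable pair is v, w, and every member of \<open>Z\<close> must lie above
    it.\<close>
  have all: "v dvd u" "w dvd u" if u: "u \<in> Z" for u
  proof -
    obtain v' w' where "v' \<in> W" "w' \<in> W" "v' dvd u" "w' dvd u" "\<not> v' dvd w'" "\<not> w' dvd v'"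
      using pairs[OF u] by blast
    then show "v dvd u" "w dvd u" using W g by auto
  qed
  have meet_g: "gcd y u = g" if "u \<in> Z - {y}" for u
  proof -
    have "gcd y u \<in> {v, w, g}" using meet[of y u] that yz(1) all W by auto
    moreover have "v dvd gcd y u" "w dvd gcd y u" using all that yz(1) by auto
    ultimately show ?thesis using vw' by auto
  qed
  have "leaf Z y"
    unfolding leaf_def using meet_g yz by auto
  then show False using assms(5) yz(1) by blast
qed

text \<open>In a leafless set of three elements the gcds of any member with the other two are
  incomparable, which gives the three non-divisibilities of \<open>is_cube\<close>.\<close>

lemma ex_cube:
  assumes "card S \<le> 9" "x \<in> S" "psi S x = 0"
  shows "\<exists>p q r. is_cube p q r x \<and> {p, q, r} \<subseteq> coatoms x"
proof -
  obtain Z where Z: "Z \<subseteq> coatoms x" "3 \<le> card Z" "\<forall>y\<in>Z. \<not> leaf Z y"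
    using ex_leafless assms by blast
  then have "card Z = 3" using card_leafless_eq_3 assms by blast
  then obtain p q r where pqr: "Z = {p, q, r}" "p \<noteq> q" "p \<noteq> r" "q \<noteq> r"
    by (metis card_3_iff)
  have "Z - {p} = {q, r}" "Z - {q} = {p, r}" "Z - {r} = {p, q}" using pqr by auto
  then have "\<not> gcd p q dvd gcd p r" "\<not> gcd p r dvd gcd p q" "\<not> gcd q r dvd gcd q p"
    using Z(3) pqr by (auto simp: leaf_def)
  then have "is_cube p q r x"
    using Z(1) pqr by (auto simp: is_cube_def coatoms_def)
  then show ?thesis using Z(1) pqr by blast
qed

end

section \<open>Position of the ninth element\<close>

context gcd_closed_set
begin

definition cube_set :: "nat \<Rightarrow> nat \<Rightarrow> nat \<Rightarrow> nat \<Rightarrow> nat set" where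
  "cube_set p q r x = {gcd p (gcd q r), gcd p q, gcd p r, gcd q r, p, q, r, x}"

text \<open>Taking \<open>p\<close>, \<open>q\<close>, \<open>r\<close> among the coatoms keeps
  \<open>e\<close> from lying strictly between one of them and \<open>x\<close>. The structure
  \<open>nine_H\<close> then appears with \<open>e\<close> below a coatom, after the two exchange
  roles.\<close>

definition cube_plus :: "nat \<Rightarrow> nat \<Rightarrow> nat \<Rightarrow> nat \<Rightarrow> nat \<Rightarrow> bool" where
  "cube_plus p q r x e \<longleftrightarrow> is_cube p q r x \<and> x \<in> S \<and> {p, q, r} \<subseteq> coatoms x \<and>
     S = insert e (cube_set p q r x) \<and> e \<notin> cube_set p q r x"

lemma is_cube_swap:
  "is_cube p q r x \<Longrightarrow> is_cube q p r x" "is_cube p q r x \<Longrightarrow> is_cube p r q x"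
  by (simp_all add: is_cube_def gcd.commute)

lemma cube_set_swap:
  "cube_set q p r x = cube_set p q r x" "cube_set p r q x = cube_set p q r x"
  by (auto simp: cube_set_def gcd.commute gcd.left_commute)

text \<open>These two transpositions generate all permutations of the coatoms, so each position of
  \<open>e\<close> is treated for one labelling only.\<close>

lemma cube_plus_swap:
  assumes "cube_plus p q r x e"
  shows "cube_plus q p r x e" "cube_plus p r q x e"
proof -
  have *: "is_cube p q r x" "x \<in> S" "p \<in> coatoms x" "q \<in> coatoms x" "r \<in> coatoms x"
    "S = insert e (cube_set p q r x)" "e \<notin> cube_set p q r x"
    using assms unfolding cube_plus_def by auto
  show "cube_plus q p r x e"
    unfolding cube_plus_def cube_set_swap[where p = p and q = q and r = r]
    by (intro conjI is_cube_swap(1)[OF *(1)] *(2-) insert_subsetI empty_subsetI)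
  show "cube_plus p r q x e"
    unfolding cube_plus_def cube_set_swap[where p = p and q = q and r = r]
    by (intro conjI is_cube_swap(2)[OF *(1)] *(2-) insert_subsetI empty_subsetI)
qed

lemma cube_set_eq_image: "cube_set p q r x = cube_map p q r x e ` (UNIV - {E})"
proof -
  have "UNIV - {E} = {Bot, A, B, C, AB, AC, BC, Top}" by (auto simp: UNIV_elt)
  then show ?thesis by (simp add: cube_set_def)
qed

lemma range_cube_map: "range (cube_map p q r x e) = insert e (cube_set p q r x)"
  by (simp add: UNIV_elt cube_set_def insert_commute)

lemma ex_cube_plus:
  assumes "card S = 9" "x \<in> S" "is_cube p q r x" "{p, q, r} \<subseteq> coatoms x"
  shows "\<exists>e. cube_plus p q r x e"
proof -
  let ?Q = "cube_set p q r x"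
  have "inj_on (cube_map p q r x 0) (UNIV - {E})"
  proof (rule inj_onI)
    fix s t assume st: "s \<in> UNIV - {E}" "t \<in> UNIV - {E}"
      and "cube_map p q r x 0 s = cube_map p q r x 0 t"
    then have "cube_le s t" "cube_le t s"
      using cube_map_dvd_iff[OF assms(3)] by (metis DiffE dvd_refl singletonI)+
    then show "s = t" using st by (cases s; cases t; simp)
  qed
  then have "card ?Q = card (UNIV - {E} :: elt set)"
    unfolding cube_set_eq_image[of p q r x 0] by (rule card_image)
  also have "\<dots> = 8" by (simp add: UNIV_elt card_Diff_singleton)
  finally have card: "card ?Q = 8" .
  have sub: "?Q \<subseteq> S"
    using assms(2,4) by (auto simp: cube_set_def coatoms_def intro: gcd)
  then have "card (S - ?Q) = 1"
    using card assms(1) finite by (simp add: card_Diff_subset finite_subset)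
  then obtain e where "S - ?Q = {e}" by (auto simp: card_1_singleton_iff)
  then have "S = insert e ?Q" "e \<notin> ?Q" using sub by auto
  then show ?thesis using assms(2-4) unfolding cube_plus_def by blast
qed

context
  fixes p q r x e
  assumes plus: "cube_plus p q r x e"
begin

lemma cube: "is_cube p q r x" and S_eq: "S = insert e (cube_set p q r x)"
  and e_notin: "e \<notin> cube_set p q r x" and coatoms_pqr: "{p, q, r} \<subseteq> coatoms x"
  and x_in: "x \<in> S"
  using plus unfolding cube_plus_def by auto

lemma e_in: "e \<in> S" using S_eq by blast

lemma pqr_in: "p \<in> S" "q \<in> S" "r \<in> S"
  using coatoms_pqr by (auto simp: coatoms_def)

lemma e_neq: "t \<noteq> E \<Longrightarrow> cube_map p q r x e t \<noteq> e"
  using e_notin unfolding cube_set_eq_image[of p q r x e]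
  by (metis DiffI UNIV_I image_eqI singletonD)

lemma obtain_cube_map:
  assumes "s \<in> S" "s \<noteq> e"
  obtains t where "t \<noteq> E" "s = cube_map p q r x e t"
  using assms S_eq unfolding cube_set_eq_image[of p q r x e] by blast

lemma cube_map_in: "cube_map p q r x e t \<in> S"
  using range_cube_map[of p q r x e] S_eq by blast

lemma cube_map_dvd:
  "s \<noteq> E \<Longrightarrow> t \<noteq> E \<Longrightarrow> cube_map p q r x e s dvd cube_map p q r x e t \<longleftrightarrow> cube_le s t"
  by (rule cube_map_dvd_iff[OF cube])

lemma iso_extension:
  assumes "ext_rel l"
    and "\<And>t. t \<noteq> E \<Longrightarrow> cube_map p q r x e t dvd e \<longleftrightarrow> below l t"
    and "\<And>t. t \<noteq> E \<Longrightarrow> e dvd cube_map p q r x e t \<longleftrightarrow> above l t"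
  shows "order_isomorphic (cube_extension l) (dvd_order S)"
proof (rule order_isomorphic_cube_extension[OF cube assms])
  show "S = range (cube_map p q r x e)" using S_eq range_cube_map by simp
  show "\<not> (below l t \<and> above l t)" if "t \<noteq> E" for t
    using that assms(2,3) e_neq dvd_antisym by blast
qed

lemma not_dvd_e:
  assumes "e dvd x" "y \<in> {p, q, r, x}"
  shows "\<not> y dvd e"
proof
  assume y: "y dvd e"
  then have "e = y \<or> e = x"
    using assms coatoms_pqr e_in by (auto simp: coatoms_def dest: dvd_antisym)
  then show False using e_notin assms(2) by (auto simp: cube_set_def)
qed

text \<open>The gcd of \<open>e\<close> with the bottom of the cube lies in \<open>S\<close> and
  differs from \<open>e\<close>, so it is a cube element below the bottom, hence the bottom
  itself.\<close>

lemma bot_dvd_e: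
  assumes "\<not> e dvd gcd p (gcd q r)"
  shows "gcd p (gcd q r) dvd e"
proof -
  let ?u = "gcd e (gcd p (gcd q r))"
  have "?u \<in> S" using gcd[OF e_in cube_map_in[of Bot]] by simp
  moreover have "?u \<noteq> e" using assms by (metis gcd_dvd2)
  ultimately obtain t where t: "t \<noteq> E" "?u = cube_map p q r x e t"
    by (rule obtain_cube_map)
  then have "cube_le t Bot" using cube_map_dvd[of t Bot] by (metis cube_map_simps(1) elt.distinct(15) gcd_dvd2)
  then have "?u = gcd p (gcd q r)" using t by simp
  then show ?thesis by (metis gcd_dvd1)
qed

text \<open>Here \<open>gcd e p\<close> would be a cube element above two atoms, so it would be
  \<open>p\<close> or \<open>x\<close>. Then \<open>p\<close> or \<open>x\<close> would divide
  \<open>e\<close>, which \<open>not_dvd_e\<close> forbids.\<close>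

lemma not_two_atoms_dvd_e:
  assumes "e dvd x" "\<not> e dvd p" "gcd p q dvd e" "gcd p r dvd e"
  shows False
proof -
  have "gcd e p \<in> S" "gcd e p \<noteq> e"
    using gcd e_in pqr_in assms(2) by (auto, metis gcd_dvd2)
  then obtain t where t: "t \<noteq> E" "gcd e p = cube_map p q r x e t"
    by (rule obtain_cube_map)
  have "cube_map p q r x e A dvd gcd e p" "cube_map p q r x e B dvd gcd e p"
    using assms(3,4) by simp_all
  then have "cube_le A t" "cube_le B t"
    using t cube_map_dvd[of A t] cube_map_dvd[of B t] by simp_all
  then have "t \<in> {AB, Top}" by auto
  then have "p dvd e \<or> x dvd e" using t by (auto, (metis gcd_dvd1)+)
  then show False using not_dvd_e[OF assms(1)] by auto
qed

text \<open>All cube elements divide \<open>x\<close>, so those dividing \<open>e\<close> are those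
  dividing \<open>gcd e x\<close>; the position of \<open>e\<close> is therefore determined by this
  one cube element.\<close>

lemma iso_not_below:
  assumes "\<not> e dvd x" "gcd e x = cube_map p q r x e s" "s \<noteq> E"
  shows "order_isomorphic (cube_extension {(s, E)}) (dvd_order S)"
proof (rule iso_extension)
  show "ext_rel {(s, E)}" using assms(3) by (simp add: ext_rel_def)
  fix t assume t: "t \<noteq> E"
  have top: "cube_map p q r x e t dvd x" using cube_map_dvd[of t Top] t by simp
  then have "cube_map p q r x e t dvd e \<longleftrightarrow> cube_map p q r x e t dvd gcd e x" by simp
  also have "\<dots> \<longleftrightarrow> cube_le t s" using assms(2,3) t cube_map_dvd by simp
  finally show "cube_map p q r x e t dvd e \<longleftrightarrow> below {(s, E)} t" by (simp add: below_def)
  show "e dvd cube_map p q r x e t \<longleftrightarrow> above {(s, E)} t"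
    using top assms(1) assms(3) by (auto simp: above_def dest: dvd_trans)
qed

end

lemma nine_of_not_below:
  assumes plus: "cube_plus p q r x e" and "\<not> e dvd x"
  shows "\<exists>R\<in>nine_structures. order_isomorphic R (dvd_order S)"
proof -
  have swaps: "cube_plus r q p x e" "cube_plus q p r x e" "cube_plus p r q x e"
    using plus cube_plus_swap by blast+
  have "gcd e x \<in> S" "gcd e x \<noteq> e"
    using gcd e_in[OF plus] x_in[OF plus] assms(2) by (auto, metis gcd_dvd2)
  then obtain t where t: "t \<noteq> E" "gcd e x = cube_map p q r x e t"
    by (rule obtain_cube_map[OF plus])
  note iso = iso_not_below[OF _ assms(2)]
  show ?thesis
  proof (cases t)
    case Bot
    then show ?thesis using iso[OF plus, of Bot] t by (auto simp: nine_structures_def nine_A_def)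
  next
    case A
    then show ?thesis using iso[OF swaps(1), of C] t
      by (auto simp: nine_structures_def nine_B_def gcd.commute)
  next
    case B
    then show ?thesis using iso[OF swaps(2), of C] t by (auto simp: nine_structures_def nine_B_def)
  next
    case C
    then show ?thesis using iso[OF plus, of C] t by (auto simp: nine_structures_def nine_B_def)
  next
    case AB
    then show ?thesis using iso[OF swaps(1), of BC] t by (auto simp: nine_structures_def nine_C_def)
  next
    case AC
    then show ?thesis using iso[OF swaps(3), of BC] t by (auto simp: nine_structures_def nine_C_def)
  next
    case BC
    then show ?thesis using iso[OF plus, of BC] t by (auto simp: nine_structures_def nine_C_def)
  next
    case Top
    then show ?thesis using iso[OF plus, of Top] t by (auto simp: nine_structures_def nine_D_def)
  qed (use t in simp)
qed

lemma iso_below_bot: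
  assumes plus: "cube_plus p q r x e" and "e dvd gcd p (gcd q r)"
  shows "order_isomorphic nine_E (dvd_order S)"
  unfolding nine_E_def
proof (rule iso_extension[OF plus ext_rel_nine(5)])
  fix t assume t: "t \<noteq> E"
  have "cube_map p q r x e Bot dvd cube_map p q r x e t"
    using cube_map_dvd[OF plus, of Bot t] t by simp
  with assms(2) have bot: "e dvd cube_map p q r x e t" by (metis cube_map_simps(1) dvd_trans)
  then show "e dvd cube_map p q r x e t \<longleftrightarrow> above {(E, Bot)} t" using t by (simp add: above_def)
  have "\<not> cube_map p q r x e t dvd e"
    using bot e_neq[OF plus t] dvd_antisym by blast
  then show "cube_map p q r x e t dvd e \<longleftrightarrow> below {(E, Bot)} t" using t by (simp add: below_def)
qed

lemma iso_below_top:
  assumes plus: "cube_plus p q r x e"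
    and "e dvd x" "\<not> e dvd p" "\<not> e dvd q" "\<not> e dvd r" "\<not> gcd p r dvd e" "\<not> gcd q r dvd e"
  shows "order_isomorphic (if gcd p q dvd e then nine_I else nine_J) (dvd_order S)"
proof -
  define l where "l = (if gcd p q dvd e then {(A, E), (E, Top)} else {(Bot, E), (E, Top)})"
  have "order_isomorphic (cube_extension l) (dvd_order S)"
  proof (rule iso_extension[OF plus])
    show "ext_rel l" by (simp add: l_def ext_rel_nine)
    fix t assume "t \<noteq> E"
    have "\<not> e dvd gcd p (gcd q r)" "\<not> e dvd gcd p q" "\<not> e dvd gcd p r" "\<not> e dvd gcd q r"
      using assms(3-5) by simp_all
    then show "e dvd cube_map p q r x e t \<longleftrightarrow> above l t"
      using \<open>t \<noteq> E\<close> assms(2-5) by (cases t; simp add: above_def l_def)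
    have "gcd p (gcd q r) dvd e"
      using bot_dvd_e[OF plus] assms(3) by simp
    then show "cube_map p q r x e t dvd e \<longleftrightarrow> below l t"
      using \<open>t \<noteq> E\<close> not_dvd_e[OF plus assms(2)] assms(6,7) by (cases t; simp add: below_def l_def)
  qed
  then show ?thesis by (simp add: l_def nine_I_def nine_J_def split: if_splits)
qed

lemma nine_of_below_top:
  assumes plus: "cube_plus p q r x e"
    and e: "e dvd x" "\<not> e dvd p" "\<not> e dvd q" "\<not> e dvd r"
  shows "\<exists>R\<in>nine_structures. order_isomorphic R (dvd_order S)"
proof -
  have swaps: "cube_plus q p r x e" "cube_plus r q p x e" "cube_plus p r q x e"
      "cube_plus q r p x e"
    using plus cube_plus_swap by blast+
  \<comment> \<open>At most one atom divides \<open>e\<close>; a relabelling makes it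
    \<open>gcd p q\<close>, as \<open>iso_below_top\<close> expects.\<close>
  have "\<not> (gcd p q dvd e \<and> gcd p r dvd e)" "\<not> (gcd p q dvd e \<and> gcd q r dvd e)"
      "\<not> (gcd p r dvd e \<and> gcd q r dvd e)"
    using not_two_atoms_dvd_e[OF plus e(1,2)] not_two_atoms_dvd_e[OF swaps(1) e(1,3)]
      not_two_atoms_dvd_e[OF swaps(2) e(1,4)] by (auto simp: gcd.commute)
  then have "\<exists>R\<in>{nine_I, nine_J}. order_isomorphic R (dvd_order S)"
    using iso_below_top[OF plus e] iso_below_top[OF swaps(3) e(1,2,4,3)]
      iso_below_top[OF swaps(4) e(1,3,4,2)]
    by (auto simp: gcd.commute split: if_splits)
  then show ?thesis by (auto simp: nine_structures_def)
qed

text \<open>The atom \<open>gcd q r\<close> cannot divide \<open>e\<close>, since it does not divide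
  \<open>p\<close>. So only the two atoms below \<open>p\<close> matter, one of which is excluded by
  assumption.\<close>

lemma iso_below_coatom:
  assumes plus: "cube_plus p q r x e"
    and "e dvd p" "\<not> e dvd q" "\<not> e dvd r" "\<not> gcd p r dvd e"
  shows "order_isomorphic (if gcd p q dvd e then nine_G else nine_F) (dvd_order S)"
proof -
  define l where "l = (if gcd p q dvd e then {(A, E), (E, AB)} else {(Bot, E), (E, AB)})"
  have dx: "e dvd x" using dvd_trans[OF assms(2)] cube[OF plus] unfolding is_cube_def by blast
  have "order_isomorphic (cube_extension l) (dvd_order S)"
  proof (rule iso_extension[OF plus])
    show "ext_rel l" by (simp add: l_def ext_rel_nine)
    fix t assume "t \<noteq> E"
    have "\<not> e dvd gcd p (gcd q r)" "\<not> e dvd gcd p q" "\<not> e dvd gcd p r" "\<not> e dvd gcd q r"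
      using assms(3,4) by simp_all
    then show "e dvd cube_map p q r x e t \<longleftrightarrow> above l t"
      using \<open>t \<noteq> E\<close> assms(2-4) dx by (cases t; simp add: above_def l_def)
    have "gcd p (gcd q r) dvd e"
      using bot_dvd_e[OF plus] assms(3) by simp
    moreover have "\<not> gcd q r dvd e"
      using dvd_trans[OF _ assms(2)] cube[OF plus] unfolding is_cube_def by blast
    ultimately show "cube_map p q r x e t dvd e \<longleftrightarrow> below l t"
      using \<open>t \<noteq> E\<close> not_dvd_e[OF plus dx] assms(5) by (cases t; simp add: below_def l_def)
  qed
  then show ?thesis by (simp add: l_def nine_F_def nine_G_def split: if_splits)
qed

text \<open>Here the ninth element \<open>e\<close> takes the place of the coatom \<open>p\<close> in the cube, and \<open>p\<close> becomes the
  added element.\<close>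

lemma iso_below_coatom_above_atoms:
  assumes plus: "cube_plus p q r x e"
    and "e dvd p" "gcd p q dvd e" "gcd p r dvd e"
  shows "order_isomorphic nine_H (dvd_order S)"
proof -
  have gcds: "gcd e q = gcd p q" "gcd e r = gcd p r"
    by (intro dvd_antisym gcd_greatest dvd_trans[OF gcd_dvd1 assms(2)] assms(3,4) gcd_dvd2)+
  then have bot: "gcd e (gcd q r) = gcd p (gcd q r)"
    by (metis gcd.assoc)
  have dx: "e dvd x" using dvd_trans[OF assms(2)] cube[OF plus] unfolding is_cube_def by blast
  have pe: "\<not> p dvd e" "e \<noteq> x"
    using not_dvd_e[OF plus dx, of p] e_notin[OF plus] by (simp_all, auto simp: cube_set_def)
  have nd: "\<not> gcd q r dvd e"
    using dvd_trans[OF _ assms(2)] cube[OF plus] unfolding is_cube_def by blast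
  have cube': "is_cube e q r x"
    using cube[OF plus] dx pe nd by (simp add: is_cube_def gcds)
  have le: "cube_map p q r x e t dvd p \<longleftrightarrow> cube_le t AB"
      "p dvd cube_map p q r x e t \<longleftrightarrow> cube_le AB t" if "t \<noteq> E" for t
    using cube_map_dvd[OF plus, of t AB] cube_map_dvd[OF plus, of AB t] that by simp_all
  show ?thesis
    unfolding nine_H_def
  proof (rule order_isomorphic_cube_extension[OF cube' ext_rel_nine(8)])
    show "S = range (cube_map e q r x p)"
      using S_eq[OF plus] by (auto simp: UNIV_elt cube_set_def gcds bot)
    fix t assume t: "t \<noteq> E"
    show "cube_map e q r x p t dvd p \<longleftrightarrow> below {(AB, E), (E, Top)} t"
      using le[of t] t assms(2) by (cases t; simp add: below_def gcds bot)
    show "p dvd cube_map e q r x p t \<longleftrightarrow> above {(AB, E), (E, Top)} t"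
      using le[of t] t pe by (cases t; simp add: above_def gcds bot)
    show "\<not> (below {(AB, E), (E, Top)} t \<and> above {(AB, E), (E, Top)} t)"
      by (auto simp: below_def above_def)
  qed
qed

lemma nine_of_below_coatom:
  assumes plus: "cube_plus p q r x e"
    and e: "e dvd p" "\<not> e dvd q" "\<not> e dvd r"
  shows "\<exists>R\<in>nine_structures. order_isomorphic R (dvd_order S)"
proof -
  have "\<exists>R\<in>{nine_F, nine_G, nine_H}. order_isomorphic R (dvd_order S)"
    using iso_below_coatom[OF plus e] iso_below_coatom[OF cube_plus_swap(2)[OF plus] e(1,3,2)]
      iso_below_coatom_above_atoms[OF plus e(1)]
    by (cases "gcd p q dvd e"; cases "gcd p r dvd e"; simp)
  then show ?thesis by (auto simp: nine_structures_def)
qed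

end

text \<open>If a is at least 6, the sum is at most 1/6 + 1/2 + 1/3 = 1. If a = 4, then b and c are
  odd and distinct, and the sum is at most 1/4 + 1/3 + 1/5 < 1.\<close>

lemma prime_of_sum_inverse_gt_1:
  fixes a b c :: nat
  assumes "2 \<le> a" "2 \<le> b" "2 \<le> c" "coprime a b" "coprime a c" "coprime b c"
    and sum: "1 < 1 / real a + 1 / real b + 1 / real c"
  shows "a \<in> {2, 3, 5}"
proof -
  have ne: "a \<noteq> b" "a \<noteq> c" "b \<noteq> c" using assms by auto
  have le: "1 / real m \<le> 1 / real n" if "n \<le> m" "0 < n" for m n
    using that by (simp add: frac_le)
  have "a < 6"
  proof (rule ccontr)
    assume "\<not> a < 6"
    then have "1 / real a \<le> 1 / 6" using le[of 6 a] by simp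
    moreover have "1 / real b + 1 / real c \<le> 1 / 2 + 1 / 3"
    proof (cases "b < c")
      case True
      then have "1 / real b \<le> 1 / 2" "1 / real c \<le> 1 / 3"
        using assms(2) le[of 2 b] le[of 3 c] by simp_all
      then show ?thesis by linarith
    next
      case False
      then have "1 / real b \<le> 1 / 3" "1 / real c \<le> 1 / 2"
        using assms(3) ne(3) le[of 3 b] le[of 2 c] by simp_all
      then show ?thesis by linarith
    qed
    ultimately show False using sum by simp
  qed
  moreover have "a \<noteq> 4"
  proof
    assume a: "a = 4"
    have odd: "odd b" "odd c"
      using assms(4,5) unfolding a
      by (auto simp: coprime_commute[of 4] dest: coprime_common_divisor[of _ 4 2])
    then have "b \<noteq> 2" "c \<noteq> 2" "b \<noteq> 4" "c \<noteq> 4" by auto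
    then have "3 \<le> b" "3 \<le> c" "5 \<le> b \<or> 5 \<le> c" using ne(3) assms(2,3) by auto
    then have "1 / real b + 1 / real c \<le> 1 / 3 + 1 / 5"
    proof (cases "5 \<le> b")
      case True
      then have "1 / real b \<le> 1 / 5" "1 / real c \<le> 1 / 3"
        using \<open>3 \<le> c\<close> le[of 5 b] le[of 3 c] by simp_all
      then show ?thesis by linarith
    next
      case False
      then have "1 / real b \<le> 1 / 3" "1 / real c \<le> 1 / 5"
        using \<open>3 \<le> b\<close> \<open>5 \<le> b \<or> 5 \<le> c\<close> le[of 3 b] le[of 5 c] by simp_all
      then show ?thesis by linarith
    qed
    then show False using sum a by simp
  qed
  ultimately show ?thesis using assms(1) by auto
qed

context gcd_closed_set
begin

text \<open>\<open>e\<close> would lie strictly between the bottom and an atom of the cube. Dividing by the bottom, the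
  atoms become pairwise coprime, and \<open>psi S x = 0\<close> forces the sum of their reciprocals above 1, so
  they become 2, 3 and 5, which leaves no room for \<open>e\<close>.\<close>

lemma not_below_two_coatoms:
  assumes plus: "cube_plus p q r x e" and psi: "psi S x = 0"
    and e: "e dvd gcd p q" "\<not> e dvd r"
  shows False
proof -
  define b where "b = gcd p (gcd q r)"
  have pos': "0 < p" "0 < q" "0 < r" "0 < x" "0 < e"
    using pos pqr_in[OF plus] x_in[OF plus] e_in[OF plus] by auto
  have dx: "p dvd x" "q dvd x" "r dvd x"
    using cube[OF plus] by (simp_all add: is_cube_def)
  \<comment> \<open>Every element of \<open>S\<close> other than \<open>x\<close> lies below one of
    the three, including \<open>e\<close>, so there is no fourth coatom.\<close>
  have coat: "coatoms x = {p, q, r}"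
  proof
    show "{p, q, r} \<subseteq> coatoms x" by (rule coatoms_pqr[OF plus])
    show "coatoms x \<subseteq> {p, q, r}"
    proof
      fix y assume y: "y \<in> coatoms x"
      have "y dvd p \<or> y dvd q \<or> y dvd r"
      proof (cases "y = e")
        case False
        have "y \<in> S" "y \<noteq> x" using y by (auto simp: coatoms_def)
        then show ?thesis using False S_eq[OF plus] by (auto simp: cube_set_def)
      qed (use e(1) in simp)
      then show "y \<in> {p, q, r}"
        using y coatoms_pqr[OF plus] antichain_coatoms[of x] unfolding antichain_def by blast
    qed
  qed
  have in_S: "gcd p q \<in> S" "gcd p r \<in> S" "gcd q r \<in> S"
    using gcd pqr_in[OF plus] by blast+
  have b_in: "b \<in> S" using cube_map_in[OF plus, of Bot] by (simp add: b_def)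
  have "ideal_sum {q, r} = 1 / real r + 1 / real q - 1 / real (gcd q r)"
    using ideal_sum_insert[of q "{r}"] ideal_sum_singleton pqr_in[OF plus] in_S by simp
  moreover have "gcd (gcd p q) (gcd p r) = b"
    by (simp add: b_def gcd.assoc gcd.left_commute)
  then have "ideal_sum {gcd p q, gcd p r} = 1 / real (gcd p r) + 1 / real (gcd p q) - 1 / real b"
    using ideal_sum_insert[of "gcd p q" "{gcd p r}"] ideal_sum_singleton in_S b_in by simp
  moreover have "ideal_sum {p, q, r} =
      ideal_sum {q, r} + 1 / real p - ideal_sum {gcd p q, gcd p r}"
    using ideal_sum_insert[of p "{q, r}"] pqr_in[OF plus] by simp
  moreover have "ideal_sum {p, q, r} = 1 / real x"
    using ideal_sum_coatoms[OF x_in[OF plus]] psi coat by simp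
  \<comment> \<open>In the inclusion-exclusion formula for \<open>1 / x\<close>, the term
    \<open>1 / p\<close> outweighs \<open>1 / x\<close>, and the positive \<open>1 / q\<close> and
    \<open>1 / r\<close> make the inequality strict.\<close>
  moreover have "1 / real x \<le> 1 / real p" "0 < 1 / real q" "0 < 1 / real r"
    using dvd_imp_le[OF dx(1)] pos' by (simp_all add: frac_le)
  ultimately have sum: "1 / real b < 1 / real (gcd p q) + 1 / real (gcd p r) + 1 / real (gcd q r)"
    by linarith
  have b: "b dvd gcd p q" "b dvd gcd p r" "b dvd gcd q r"
    unfolding b_def by (meson dvd_trans gcd_dvd1 gcd_dvd2 gcd_greatest)+
  then obtain u v w where uvw: "gcd p q = b * u" "gcd p r = b * v" "gcd q r = b * w"
    by (elim dvdE)
  have b_pos: "0 < b" using pos' by (simp add: b_def)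
  have gcds: "gcd (b * u) (b * v) = b" "gcd (b * u) (b * w) = b" "gcd (b * v) (b * w) = b"
    unfolding uvw[symmetric] by (simp_all add: b_def gcd.assoc gcd.left_commute gcd.commute)
  then have cop: "coprime u v" "coprime u w" "coprime v w"
    using b_pos by (simp_all add: gcd_mult_distrib_nat[symmetric] coprime_iff_gcd_eq_1)
  have "\<not> gcd p q dvd b" "\<not> gcd p r dvd b" "\<not> gcd q r dvd b"
    using cube[OF plus] by (auto simp: is_cube_def b_def)
  then have "u \<noteq> 1" "v \<noteq> 1" "w \<noteq> 1" unfolding uvw by auto
  moreover have "u \<noteq> 0" "v \<noteq> 0" "w \<noteq> 0"
    using uvw pos' by (metis gcd_eq_0_iff less_numeral_extra(3) mult_0_right)+
  ultimately have ge: "2 \<le> u" "2 \<le> v" "2 \<le> w" by auto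
  have "1 < 1 / real u + 1 / real v + 1 / real w"
    using sum b_pos unfolding uvw by (simp add: field_simps)
  then have "u \<in> {2, 3, 5}" by (rule prime_of_sum_inverse_gt_1[OF ge cop])
  then have "prime u" by auto
  \<comment> \<open>Now \<open>e\<close> is \<open>b\<close> times a divisor of the prime
    \<open>u\<close>, so it is either the bottom or the atom \<open>gcd p q\<close>, both already in
    the cube.\<close>
  have "\<not> e dvd b" using e(2) by (auto simp: b_def)
  then have "b dvd e" unfolding b_def by (rule bot_dvd_e[OF plus])
  then obtain k where k: "e = b * k" by blast
  then have "k dvd u" using e(1) b_pos unfolding uvw by simp
  then have "k = 1 \<or> k = u" using \<open>prime u\<close> by (simp add: prime_nat_iff)
  then have "e = b \<or> e = gcd p q" using k uvw by auto
  then show False using e_notin[OF plus] by (auto simp: cube_set_def b_def)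
qed

section \<open>Classification by the position of the ninth element\<close>

lemma nine_of_singular:
  assumes "card S = 9" "singular_mat (lcm_matrix S)"
  shows "\<exists>R\<in>nine_structures. order_isomorphic R (dvd_order S)"
proof -
  obtain x where x: "x \<in> S" "psi S x = 0" using ex_psi_eq_0 assms(2) by blast
  then obtain p q r where "is_cube p q r x" "{p, q, r} \<subseteq> coatoms x"
    using ex_cube assms(1) by (metis order_refl)
  then obtain e where plus: "cube_plus p q r x e" using ex_cube_plus assms(1) x(1) by blast
  then have swaps: "cube_plus q p r x e" "cube_plus r q p x e" "cube_plus p r q x e"
      "cube_plus q r p x e"
    using cube_plus_swap by blast+
  note no = not_below_two_coatoms[OF _ x(2)]
  \<comment> \<open>The cases record which coatoms \<open>e\<close> divides; dividing exactly two of
    them is the impossible position.\<close>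
  consider "\<not> e dvd x" | "e dvd x" "\<not> e dvd p" "\<not> e dvd q" "\<not> e dvd r"
    | "e dvd p" "\<not> e dvd q" "\<not> e dvd r" | "e dvd q" "\<not> e dvd p" "\<not> e dvd r"
    | "e dvd r" "\<not> e dvd q" "\<not> e dvd p" | "e dvd gcd p q" "\<not> e dvd r"
    | "e dvd gcd p r" "\<not> e dvd q" | "e dvd gcd q r" "\<not> e dvd p" | "e dvd gcd p (gcd q r)"
    by auto
  then show ?thesis
  proof cases
    case 1
    then show ?thesis by (rule nine_of_not_below[OF plus])
  next
    case 2
    then show ?thesis by (rule nine_of_below_top[OF plus])
  next
    case 3
    then show ?thesis by (rule nine_of_below_coatom[OF plus])
  next
    case 4
    then show ?thesis by (rule nine_of_below_coatom[OF swaps(1)])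
  next
    case 5
    then show ?thesis by (rule nine_of_below_coatom[OF swaps(2)])
  next
    case 6
    then show ?thesis using no[OF plus] by blast
  next
    case 7
    then show ?thesis using no[OF swaps(3)] by blast
  next
    case 8
    then show ?thesis using no[OF swaps(4)] by blast
  next
    case 9
    then show ?thesis using iso_below_bot[OF plus] by (auto simp: nine_structures_def)
  qed
qed

end

section \<open>Realizations\<close>

lemma lower_semilattice_dvd_order:
  assumes "gcd_closed S"
  shows "lower_semilattice (dvd_order S)"
proof
  fix x y assume "x \<in> carrier (dvd_order S)" "y \<in> carrier (dvd_order S)"
  then have "greatest (dvd_order S) (gcd x y) (Lower (dvd_order S) {x, y})"
    using assms by (auto simp: greatest_def Lower_def dvd_order_def gcd_closed_def)
  then show "\<exists>s. greatest (dvd_order S) s (Lower (dvd_order S) {x, y})" by blast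
qed (auto simp: dvd_order_def dest: dvd_antisym dvd_trans)

text \<open>Lets the ten structures inherit their meets from realizing GCD closed sets. The equality
  stored in a \<open>gorder\<close> is not transported by \<open>order_isomorphic\<close>, hence the
  separate assumption on it.\<close>

lemma lower_semilattice_order_isomorphic:
  assumes "lower_semilattice P" "order_isomorphic P R" "(.=\<^bsub>R\<^esub>) = (=)"
  shows "lower_semilattice R"
proof -
  interpret P: lower_semilattice P by fact
  obtain f where f: "bij_betw f (carrier P) (carrier R)"
    and le: "\<And>x y. x \<in> carrier P \<Longrightarrow> y \<in> carrier P \<Longrightarrow> f x \<sqsubseteq>\<^bsub>R\<^esub> f y \<longleftrightarrow> x \<sqsubseteq>\<^bsub>P\<^esub> y"
    using assms(2) unfolding order_isomorphic_def order_iso_def by blast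
  have R: "carrier R = f ` carrier P" using f by (simp add: bij_betw_def)
  show ?thesis
  proof
    fix x y assume "x \<in> carrier R" "y \<in> carrier R"
    then obtain u v where uv: "u \<in> carrier P" "v \<in> carrier P" "x = f u" "y = f v"
      unfolding R by blast
    then obtain s where s: "greatest P s (Lower P {u, v})"
      using P.inf_of_two_exists by blast
    have "greatest R (f s) (Lower R {x, y})"
      using s uv by (auto simp: greatest_def Lower_def R le)
    then show "\<exists>s. greatest R s (Lower R {x, y})" by blast
  qed (auto simp: assms(3) R le dest: P.le_trans P.le_antisym)
qed

lemma range_elt: "range f = {f Bot, f A, f B, f C, f AB, f AC, f BC, f Top, f E}"
  by (simp add: UNIV_elt)

text \<open>The cube is gcd closed for any choice of numbers, so in each realization only gcds with
  \<open>e\<close> remain to be checked.\<close>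

lemma gcd_cube_map_in_range:
  assumes "is_cube p q r x" "s \<noteq> E" "t \<noteq> E"
  shows "gcd (cube_map p q r x e s) (cube_map p q r x e t) \<in> range (cube_map p q r x e)"
proof -
  have "p dvd x" "q dvd x" "r dvd x" using assms(1) by (simp_all add: is_cube_def)
  then have x: "gcd p x = p" "gcd q x = q" "gcd r x = r"
    by simp_all
  show ?thesis
    using assms(2,3) x
    by (cases s; cases t; simp add: range_elt gcd.assoc gcd.commute gcd.left_commute)
qed

definition realizable :: "'a gorder \<Rightarrow> bool" where
  "realizable P \<longleftrightarrow> (\<exists>S. card S = 9 \<and> (\<forall>x\<in>S. 0 < x) \<and> gcd_closed S \<and>
     order_isomorphic P (dvd_order S) \<and> singular_mat (lcm_matrix S))"

text \<open>Since \<open>lcm z y\<close> is z * y / \<open>gcd z y\<close>, dividing the weights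
  \<open>m\<close> by the numbers they belong to gives a kernel vector of the LCM matrix. All
  hypotheses become finite checks once the numbers are given.\<close>

lemma realizable_cube_extension:
  fixes m :: "elt \<Rightarrow> real"
  assumes cube: "is_cube p q r x" and l: "ext_rel l"
    and below: "\<forall>t. t \<noteq> E \<longrightarrow> (cube_map p q r x e t dvd e \<longleftrightarrow> below l t)"
    and above: "\<forall>t. t \<noteq> E \<longrightarrow> (e dvd cube_map p q r x e t \<longleftrightarrow> above l t)"
    and excl: "\<forall>t. t \<noteq> E \<longrightarrow> \<not> (below l t \<and> above l t)"
    and pos: "\<forall>t. 0 < cube_map p q r x e t"
    and gcds: "\<forall>t. gcd e (cube_map p q r x e t) \<in> range (cube_map p q r x e)"
    and m: "m t0 \<noteq> 0"
    and kernel: "\<forall>s. (\<Sum>t\<in>UNIV. m t / real (gcd (cube_map p q r x e s) (cube_map p q r x e t))) = 0"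
  shows "realizable (cube_extension l)"
proof -
  define h where "h = cube_map p q r x e"
  define S where "S = range h"
  have iso: "order_isomorphic (cube_extension l) (dvd_order S)"
    using order_isomorphic_cube_extension[OF cube l _ _ _, of e S] below above excl
    by (simp add: S_def h_def)
  then obtain f where "bij_betw f (UNIV :: elt set) S"
    by (auto simp: order_isomorphic_def order_iso_def dvd_order_def)
  then have "card S = card (UNIV :: elt set)" using bij_betw_same_card by metis
  then have "inj h" "card S = 9"
    by (simp_all add: S_def eq_card_imp_inj_on, simp add: UNIV_elt)
  note card = this(2,1)
  have h_pos: "0 < h t" for t using pos by (simp add: h_def)
  define c where "c y = m (inv_into UNIV h y) / real y" for y
  have "c (h t0) \<noteq> 0" using m h_pos card(2) by (simp add: c_def)
  moreover have "(\<Sum>y\<in>S. real (lcm z y) * c y) = 0" if "z \<in> S" for z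
  proof -
    obtain s where s: "z = h s" using \<open>z \<in> S\<close> by (auto simp: S_def)
    have "real (lcm z (h t)) * c (h t) = real z * (m t / real (gcd (h s) (h t)))" for t
    proof -
      have "real (lcm z (h t)) * real (gcd z (h t)) = real z * real (h t)"
        by (metis mult.commute of_nat_mult prod_gcd_lcm_nat)
      moreover have "gcd z (h t) \<noteq> 0" using h_pos[of t] by simp
      ultimately show ?thesis
        using h_pos[of t] card(2) s by (simp add: c_def field_simps)
    qed
    then have "(\<Sum>y\<in>S. real (lcm z y) * c y) = real z * (\<Sum>t\<in>UNIV. m t / real (gcd (h s) (h t)))"
      unfolding S_def by (simp add: sum.reindex[OF card(2)] sum_distrib_left)
    then show ?thesis using kernel by (simp add: h_def)
  qed
  moreover have "finite S" "h t0 \<in> S" by (simp_all add: S_def)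
  ultimately have "singular_mat (lcm_matrix S)" using singular_lcm_matrix_iff by blast
  moreover have "gcd (h s) (h t) \<in> S" for s t
    using gcds gcd_cube_map_in_range[OF cube, of s t e] rangeI[of "cube_map p q r x e" E]
    by (cases "s = E"; cases "t = E") (simp_all add: S_def h_def gcd.commute)
  then have "gcd_closed S" by (auto simp: gcd_closed_def S_def)
  moreover have "\<forall>x\<in>S. 0 < x" using h_pos by (auto simp: S_def)
  ultimately show ?thesis using card iso unfolding realizable_def by blast
qed

text \<open>The Moebius function \<open>t \<mapsto> \<mu>(t, Top)\<close> of the cube; its value at \<open>t\<close> divided by the number
  representing \<open>t\<close> is the entry of a kernel vector of the LCM matrix.\<close>

definition cube_mobius :: "elt \<Rightarrow> real" where
  "cube_mobius t = (if t = E then 0 else if t \<in> {Top, A, B, C} then 1 else - 1)"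




section \<open>Explicit GCD closed sets for the ten structures\<close>

lemma realizable_nine_A: "realizable nine_A"
proof -
  \<comment> \<open>The top is the lcm of the coatoms, and 1 - 1/2 - 1/3 - 1/5 + 1/36 + 1/230 +
    1/825 = 1/227700, so \<open>psi\<close> vanishes there. The prime 7 divides no cube element;
    multiplying 1, 5 or 825 by it gives \<open>e\<close> for \<open>nine_A\<close>,
    \<open>nine_B\<close> and \<open>nine_C\<close>.\<close>
  have h: "cube_map 36 230 825 227700 7 = elt_table 1 2 3 5 36 230 825 227700 7"
    by (simp add: cube_map_def gcd_non_0_nat)
  show ?thesis
    unfolding nine_A_def
    by (rule realizable_cube_extension[where p = 36 and q = 230 and r = 825 and x = 227700
          and e = 7 and m = "cube_mobius" and ?t0.0 = Top, OF _ ext_rel_nine(1)])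
      (simp_all add: h elt_table_def is_cube_def all_elt range_elt sum_elt gcd_non_0_nat
        below_def above_def cube_mobius_def)
qed

lemma realizable_nine_B: "realizable nine_B"
proof -
  have h: "cube_map 36 230 825 227700 35 = elt_table 1 2 3 5 36 230 825 227700 35"
    by (simp add: cube_map_def gcd_non_0_nat)
  show ?thesis
    unfolding nine_B_def
    by (rule realizable_cube_extension[where p = 36 and q = 230 and r = 825 and x = 227700
          and e = 35 and m = "cube_mobius" and ?t0.0 = Top, OF _ ext_rel_nine(2)])
      (simp_all add: h elt_table_def is_cube_def all_elt range_elt sum_elt gcd_non_0_nat
        below_def above_def cube_mobius_def)
qed

lemma realizable_nine_C: "realizable nine_C"
proof -
  have h: "cube_map 36 230 825 227700 5775 = elt_table 1 2 3 5 36 230 825 227700 5775"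
    by (simp add: cube_map_def gcd_non_0_nat)
  show ?thesis
    unfolding nine_C_def
    by (rule realizable_cube_extension[where p = 36 and q = 230 and r = 825 and x = 227700
          and e = 5775 and m = "cube_mobius" and ?t0.0 = Top, OF _ ext_rel_nine(3)])
      (simp_all add: h elt_table_def is_cube_def all_elt range_elt sum_elt gcd_non_0_nat
        below_def above_def cube_mobius_def)
qed

lemma realizable_nine_D: "realizable nine_D"
proof -
  have h: "cube_map 36 230 825 227700 455400 = elt_table 1 2 3 5 36 230 825 227700 455400"
    by (simp add: cube_map_def gcd_non_0_nat)
  show ?thesis
    unfolding nine_D_def
    by (rule realizable_cube_extension[where p = 36 and q = 230 and r = 825 and x = 227700
          and e = 455400 and m = "cube_mobius" and ?t0.0 = Top, OF _ ext_rel_nine(4)])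
      (simp_all add: h elt_table_def is_cube_def all_elt range_elt sum_elt gcd_non_0_nat
        below_def above_def cube_mobius_def)
qed

lemma realizable_nine_E: "realizable nine_E"
proof -
  \<comment> \<open>The same cube multiplied by 2, which makes room for 1 as a new bottom.\<close>
  have h: "cube_map 72 460 1650 455400 1 = elt_table 2 4 6 10 72 460 1650 455400 1"
    by (simp add: cube_map_def gcd_non_0_nat)
  show ?thesis
    unfolding nine_E_def
    by (rule realizable_cube_extension[where p = 72 and q = 460 and r = 1650 and x = 455400
          and e = 1 and m = "cube_mobius" and ?t0.0 = Top, OF _ ext_rel_nine(5)])
      (simp_all add: h elt_table_def is_cube_def all_elt range_elt sum_elt gcd_non_0_nat
        below_def above_def cube_mobius_def)
qed

lemma realizable_nine_F: "realizable nine_F"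
proof -
  \<comment> \<open>The coatom 230 takes the place of \<open>AB\<close> because its prime factor 23
    divides neither of the other coatoms.\<close>
  have h: "cube_map 230 36 825 227700 23 = elt_table 1 2 5 3 230 36 825 227700 23"
    by (simp add: cube_map_def gcd_non_0_nat)
  show ?thesis
    unfolding nine_F_def
    by (rule realizable_cube_extension[where p = 230 and q = 36 and r = 825 and x = 227700
          and e = 23 and m = "cube_mobius" and ?t0.0 = Top, OF _ ext_rel_nine(6)])
      (simp_all add: h elt_table_def is_cube_def all_elt range_elt sum_elt gcd_non_0_nat
        below_def above_def cube_mobius_def)
qed

lemma realizable_nine_G: "realizable nine_G"
proof -
  have h: "cube_map 36 230 825 227700 4 = elt_table 1 2 3 5 36 230 825 227700 4"
    by (simp add: cube_map_def gcd_non_0_nat)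
  show ?thesis
    unfolding nine_G_def
    by (rule realizable_cube_extension[where p = 36 and q = 230 and r = 825 and x = 227700
          and e = 4 and m = "cube_mobius" and ?t0.0 = Top, OF _ ext_rel_nine(7)])
      (simp_all add: h elt_table_def is_cube_def all_elt range_elt sum_elt gcd_non_0_nat
        below_def above_def cube_mobius_def)
qed

lemma realizable_nine_H: "realizable nine_H"
proof -
  \<comment> \<open>The cube now has 6 in place of 36, and 36 returns as the added element; its
    Moebius weight moves from \<open>AB\<close> to \<open>E\<close>.\<close>
  have h: "cube_map 6 230 825 227700 36 = elt_table 1 2 3 5 6 230 825 227700 36"
    by (simp add: cube_map_def gcd_non_0_nat)
  show ?thesis
    unfolding nine_H_def
    by (rule realizable_cube_extension[where p = 6 and q = 230 and r = 825 and x = 227700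
          and e = 36 and m = "cube_mobius(AB := 0, E := -1)" and ?t0.0 = Top, OF _ ext_rel_nine(8)])
      (simp_all add: h elt_table_def is_cube_def all_elt range_elt sum_elt gcd_non_0_nat
        below_def above_def cube_mobius_def)
qed

lemma realizable_nine_I: "realizable nine_I"
proof -
  \<comment> \<open>Here 4 is a fourth coatom of 180. The Moebius weights are -1 at the four coatoms
    and 2 at the atom 2, which lies below three of them.\<close>
  have h: "cube_map 6 10 45 180 4 = elt_table 1 2 3 5 6 10 45 180 4"
    by (simp add: cube_map_def gcd_non_0_nat)
  show ?thesis
    unfolding nine_I_def
    by (rule realizable_cube_extension[where p = 6 and q = 10 and r = 45 and x = 180
          and e = 4 and m = "cube_mobius(A := 2, E := -1)" and ?t0.0 = Top, OF _ ext_rel_nine(9)])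
      (simp_all add: h elt_table_def is_cube_def all_elt range_elt sum_elt gcd_non_0_nat
        below_def above_def cube_mobius_def)
qed

lemma realizable_nine_J: "realizable nine_J"
proof -
  \<comment> \<open>Again \<open>e\<close> is a fourth coatom, now above the bottom only, so the
    Moebius weight of the bottom becomes 0. The kernel equation at the top reads 1/2850 - 1/15 -
    1/57 - 1/475 - 1/2 + 1/3 + 1/5 + 1/19 = 0.\<close>
  have h: "cube_map 15 57 475 2850 2 = elt_table 1 3 5 19 15 57 475 2850 2"
    by (simp add: cube_map_def gcd_non_0_nat)
  show ?thesis
    unfolding nine_J_def
    by (rule realizable_cube_extension[where p = 15 and q = 57 and r = 475 and x = 2850
          and e = 2 and m = "cube_mobius(Bot := 0, E := -1)" and ?t0.0 = Top, OF _ ext_rel_nine(10)])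
      (simp_all add: h elt_table_def is_cube_def all_elt range_elt sum_elt gcd_non_0_nat
        below_def above_def cube_mobius_def)
qed

section \<open>Assembly of the classification\<close>

lemma realizable_nine_structures: "R \<in> nine_structures \<Longrightarrow> realizable R"
  unfolding nine_structures_def
  using realizable_nine_A realizable_nine_B realizable_nine_C realizable_nine_D realizable_nine_E
    realizable_nine_F realizable_nine_G realizable_nine_H realizable_nine_I realizable_nine_J
  by blast

lemma nine_structures_cube_extension:
  "R \<in> nine_structures \<Longrightarrow> \<exists>r. R = cube_extension r"
  by (auto simp: nine_structures_def nine_A_def nine_B_def nine_C_def nine_D_def nine_E_def
      nine_F_def nine_G_def nine_H_def nine_I_def nine_J_def)

lemma lower_semilattice_nine_structures:
  assumes "R \<in> nine_structures"
  shows "lower_semilattice R" "card (carrier R) = 9"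
proof -
  obtain r where r: "R = cube_extension r" using nine_structures_cube_extension assms by blast
  show "card (carrier R) = 9" by (simp add: r UNIV_elt)
  obtain S where "gcd_closed S" "order_isomorphic R (dvd_order S)"
    using realizable_nine_structures[OF assms] unfolding realizable_def by blast
  then show "lower_semilattice R"
    using lower_semilattice_dvd_order lower_semilattice_order_isomorphic order_isomorphic_sym
    by (metis r cube_extension_def gorder.select_convs(1) eq_object.select_convs(1))
qed

theorem mainTheorem1:
  shows "card nine_structures = 10 \<and>
    (\<forall>R\<in>nine_structures. lower_semilattice R \<and> card (carrier R) = 9) \<and>
    (\<forall>R\<in>nine_structures. \<forall>R'\<in>nine_structures. order_isomorphic R R' \<longrightarrow> R = R') \<and>
    (\<forall>P :: 'a gorder. lower_semilattice P \<and> card (carrier P) = 9 \<longrightarrow>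
       ((\<exists>S :: nat set. card S = 9 \<and> (\<forall>x\<in>S. 0 < x) \<and> gcd_closed S \<and>
            order_isomorphic (dvd_order S) P \<and> singular_mat (lcm_matrix S))
        \<longleftrightarrow> (\<exists>R\<in>nine_structures. order_isomorphic P R)))"
proof (intro conjI ballI allI impI)
  show "card nine_structures = 10" by (rule card_nine_structures)
next
  fix R :: "elt gorder" assume "R \<in> nine_structures"
  then show "lower_semilattice R" "card (carrier R) = 9"
    by (rule lower_semilattice_nine_structures)+
next
  fix R R' :: "elt gorder"
  assume "R \<in> nine_structures" "R' \<in> nine_structures" "order_isomorphic R R'"
  then show "R = R'"
    using inj_on_downset_invariant downset_invariant_cong by (blast dest: inj_onD)
next
  fix P :: "'a gorder"
  show "(\<exists>S :: nat set. card S = 9 \<and> (\<forall>x\<in>S. 0 < x) \<and> gcd_closed S \<and>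
            order_isomorphic (dvd_order S) P \<and> singular_mat (lcm_matrix S))
        \<longleftrightarrow> (\<exists>R\<in>nine_structures. order_isomorphic P R)"
  proof
    assume "\<exists>S :: nat set. card S = 9 \<and> (\<forall>x\<in>S. 0 < x) \<and> gcd_closed S \<and>
            order_isomorphic (dvd_order S) P \<and> singular_mat (lcm_matrix S)"
    then obtain S :: "nat set" where S: "card S = 9" "\<forall>x\<in>S. 0 < x" "gcd_closed S"
        "order_isomorphic (dvd_order S) P" "singular_mat (lcm_matrix S)"
      by blast
    interpret gcd_closed_set S
      using S(1-3) by unfold_locales (auto simp: gcd_closed_def intro: card_ge_0_finite)
    show "\<exists>R\<in>nine_structures. order_isomorphic P R"
      using nine_of_singular[OF S(1,5)] S(4) order_isomorphic_sym order_isomorphic_trans by blast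
  next
    assume "\<exists>R\<in>nine_structures. order_isomorphic P R"
    then obtain R where R: "R \<in> nine_structures" "order_isomorphic P R" by blast
    then obtain S where "card S = 9" "\<forall>x\<in>S. 0 < x" "gcd_closed S"
        "order_isomorphic R (dvd_order S)" "singular_mat (lcm_matrix S)"
      using realizable_nine_structures unfolding realizable_def by blast
    then show "\<exists>S :: nat set. card S = 9 \<and> (\<forall>x\<in>S. 0 < x) \<and> gcd_closed S \<and>
            order_isomorphic (dvd_order S) P \<and> singular_mat (lcm_matrix S)"
      using order_isomorphic_sym order_isomorphic_trans R(2) by blast
  qed
qed

end
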